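(* Let $k\ge 2$. A UCRPQ has semantic tree-width at most $k$ (i.e., is equivalent to a UC2RPQ of tree-width at most $k$) if and only if it has one-way semantic tree-width at most $k$ (i.e., is equivalent to a UCRPQ of tree-width at most $k$).
   Context: Fix a finite alphabet $\mathbb{A}$. A graph database $G$ is a finite directed edge-labelled graph with node set $V(G)$ and edge set $E(G)\subseteq V(G)\times\mathbb{A}\times V(G)$. Let $\mathbb{A}^\pm=\mathbb{A}\cup\{a^-: a\in\mathbb{A}\}$, and let $G^\pm$ be obtained from $G$ by adding an edge $y\xrightarrow{a^-}x$ for every edge $x\xrightarrow{a}y$ of $G$. A C2RPQ $\gamma(z_1,\dots,z_n)$ consists of a tuple of output variables (repetitions allowed) and a finite conjunction $\bigwedge_{j=1}^m x_j\xrightarrow{L_j}y_j$ ($m\ge 0$) of atoms, each $L_j$ being a regular language over $\mathbb{A}^\pm$; non-output variables are existentially quantified. A CRPQ is a C2RPQ whose languages are all over $\mathbb{A}$. A tuple $(u_1,\dots,u_n)$ of nodes satisfies $\gamma$ on $G$ if there is a map $f$ from the variables of $\gamma$ to $V(G)$ with $f(z_i)=u_i$ for all $i$ and such that for every $j$ there is a (possibly empty) directed path in $G^\pm$ from $f(x_j)$ to $f(y_j)$ labelled by a word of $L_j$. A UC2RPQ (resp. UCRPQ) is a finite set of C2RPQs (resp. CRPQs) with the same output arity, interpreted as a union. Two queries are equivalent if they are satisfied by the same tuples on every graph database. The tree-width of a C2RPQ is that of its underlying multigraph (vertices are the variables, one edge per atom); that of a UC2RPQ is the maximum over its C2RPQs.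 *)

theory Defs
  imports Main "HOL-Library.Multiset"
begin

section \<open>Edge-labelled graphs and paths\<close>

record ('v, 'l) lgraph =
  nodes :: "'v set"
  edges :: "('v \<times> 'l \<times> 'v) set"

definition graph_db :: "('v, 'l) lgraph \<Rightarrow> bool" where
  "graph_db G \<longleftrightarrow> finite (nodes G) \<and> finite (edges G) \<and>
     edges G \<subseteq> nodes G \<times> UNIV \<times> nodes G"

fun lpath :: "('v, 'l, 'z) lgraph_scheme \<Rightarrow> 'v \<Rightarrow> 'l list \<Rightarrow> 'v \<Rightarrow> bool" where
  "lpath G x [] y \<longleftrightarrow> x \<in> nodes G \<and> x = y"
| "lpath G x (l # w) y \<longleftrightarrow> (\<exists>z. (x, l, z) \<in> edges G \<and> lpath G z w y)"

text \<open>Letters of \<open>A\<^sup>\<plusminus>\<close>: \<open>Fwd a\<close> stands for \<open>a\<close> and \<open>Bwd a\<close> for its formal inverse \<open>a\<^sup>-\<close>.\<close>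

datatype 'a letter = Fwd 'a | Bwd 'a

definition two_way :: "('v, 'a) lgraph \<Rightarrow> ('v, 'a letter) lgraph" where
  "two_way G = \<lparr> nodes = nodes G,
     edges = {(x, Fwd a, y) | x a y. (x, a, y) \<in> edges G} \<union>
             {(y, Bwd a, x) | x a y. (x, a, y) \<in> edges G} \<rparr>"


section \<open>Regular languages\<close>

text \<open>A nondeterministic finite automaton is a finite labelled graph whose nodes are the states,
  together with sets of initial and final states. States can be taken to be natural numbers, as
  only finitely many are used.\<close>

record 'l nfa = "(nat, 'l) lgraph" +
  initial :: "nat set"
  final :: "nat set"

definition is_nfa :: "'l nfa \<Rightarrow> bool" where
  "is_nfa M \<longleftrightarrow> graph_db (lgraph.truncate M) \<and> initial M \<subseteq> nodes M \<and> final M \<subseteq> nodes M"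

definition nfa_language :: "'l nfa \<Rightarrow> 'l list set" where
  "nfa_language M = {w. \<exists>p \<in> initial M. \<exists>q \<in> final M. lpath M p w q}"

definition regular :: "'l list set \<Rightarrow> bool" where
  "regular L \<longleftrightarrow> (\<exists>M. is_nfa M \<and> L = nfa_language M)"


section \<open>Queries\<close>

text \<open>Atoms \<open>(x, L, y)\<close> are kept in a list, so that the same atom may occur several times.\<close>

record ('x, 'a) query =
  outs :: "'x list"
  atoms :: "('x \<times> 'a letter list set \<times> 'x) list"

definition vars :: "('x, 'a) query \<Rightarrow> 'x set" where
  "vars \<gamma> = set (outs \<gamma>) \<union> (\<Union>(x, L, y) \<in> set (atoms \<gamma>). {x, y})"

definition c2rpq :: "('x, 'a) query \<Rightarrow> bool" where
  "c2rpq \<gamma> \<longleftrightarrow> (\<forall>(x, L, y) \<in> set (atoms \<gamma>). regular L)"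

definition crpq :: "('x, 'a) query \<Rightarrow> bool" where
  "crpq \<gamma> \<longleftrightarrow> c2rpq \<gamma> \<and> (\<forall>(x, L, y) \<in> set (atoms \<gamma>). L \<subseteq> lists (range Fwd))"

definition sat :: "('v, 'a) lgraph \<Rightarrow> ('x, 'a) query \<Rightarrow> 'v list \<Rightarrow> bool" where
  "sat G \<gamma> us \<longleftrightarrow> (\<exists>f. f ` vars \<gamma> \<subseteq> nodes G \<and> map f (outs \<gamma>) = us \<and>
     (\<forall>(x, L, y) \<in> set (atoms \<gamma>). \<exists>w \<in> L. lpath (two_way G) (f x) w (f y)))"

text \<open>Unions carry their arity \<open>n\<close> explicitly, since the empty union does not determine it.\<close>

definition uc2rpq :: "nat \<Rightarrow> ('x, 'a) query set \<Rightarrow> bool" where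
  "uc2rpq n \<Gamma> \<longleftrightarrow> finite \<Gamma> \<and> (\<forall>\<gamma> \<in> \<Gamma>. c2rpq \<gamma> \<and> length (outs \<gamma>) = n)"

definition ucrpq :: "nat \<Rightarrow> ('x, 'a) query set \<Rightarrow> bool" where
  "ucrpq n \<Gamma> \<longleftrightarrow> finite \<Gamma> \<and> (\<forall>\<gamma> \<in> \<Gamma>. crpq \<gamma> \<and> length (outs \<gamma>) = n)"

definition usat :: "('v, 'a) lgraph \<Rightarrow> ('x, 'a) query set \<Rightarrow> 'v list \<Rightarrow> bool" where
  "usat G \<Gamma> us \<longleftrightarrow> (\<exists>\<gamma> \<in> \<Gamma>. sat G \<gamma> us)"

text \<open>Every graph database is finite, hence isomorphic to one whose nodes are natural numbers;
  satisfaction is invariant under isomorphism.\<close>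

definition equivalent :: "('x, 'a) query set \<Rightarrow> ('y, 'a) query set \<Rightarrow> bool" where
  "equivalent \<Gamma> \<Delta> \<longleftrightarrow>
     (\<forall>G :: (nat, 'a) lgraph. graph_db G \<longrightarrow> (\<forall>us. usat G \<Gamma> us \<longleftrightarrow> usat G \<Delta> us))"


section \<open>Tree-width\<close>

text \<open>Undirected edges are sets \<open>{u, v}\<close>; in a multigraph they form a multiset and a self-loop at
  \<open>u\<close> is the singleton \<open>{u}\<close>.\<close>

definition walk :: "'t set \<Rightarrow> 't set set \<Rightarrow> 't list \<Rightarrow> bool" where
  "walk N E p \<longleftrightarrow> p \<noteq> [] \<and> set p \<subseteq> N \<and> successively (\<lambda>u v. {u, v} \<in> E) p"

definition connected_in :: "'t set \<Rightarrow> 't set set \<Rightarrow> bool" where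
  "connected_in N E \<longleftrightarrow> N \<noteq> {} \<and>
     (\<forall>u \<in> N. \<forall>v \<in> N. \<exists>p. walk N E p \<and> hd p = u \<and> last p = v)"

definition cycle_in :: "'t set \<Rightarrow> 't set set \<Rightarrow> 't list \<Rightarrow> bool" where
  "cycle_in N E p \<longleftrightarrow> walk N E p \<and> distinct p \<and> length p \<ge> 3 \<and> {last p, hd p} \<in> E"

definition is_tree :: "'t set \<Rightarrow> 't set set \<Rightarrow> bool" where
  "is_tree N E \<longleftrightarrow> finite N \<and> E \<subseteq> {{u, v} | u v. u \<in> N \<and> v \<in> N \<and> u \<noteq> v} \<and>
     connected_in N E \<and> (\<nexists>p. cycle_in N E p)"

record 'x multigraph =
  mverts :: "'x set"
  medges :: "'x set multiset"

text \<open>\<open>connected_in\<close> includes nonemptiness, so the last conjunct also says that every vertex lies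
  in some bag.\<close>

definition tree_decomposition ::
  "'x multigraph \<Rightarrow> nat set \<Rightarrow> nat set set \<Rightarrow> (nat \<Rightarrow> 'x set) \<Rightarrow> bool" where
  "tree_decomposition H N E B \<longleftrightarrow> is_tree N E \<and>
     (\<forall>t \<in> N. B t \<subseteq> mverts H) \<and>
     (\<forall>e \<in># medges H. \<exists>t \<in> N. e \<subseteq> B t) \<and>
     (\<forall>v \<in> mverts H. connected_in {t \<in> N. v \<in> B t} E)"

text \<open>The subtraction truncates only if all bags are empty; thus the graph without vertices gets
  tree-width \<open>0\<close> rather than \<open>-1\<close>.\<close>

definition decomposition_width :: "nat set \<Rightarrow> (nat \<Rightarrow> 'x set) \<Rightarrow> nat" where
  "decomposition_width N B = Max ((\<lambda>t. card (B t)) ` N) - 1"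

definition tree_width :: "'x multigraph \<Rightarrow> nat" where
  "tree_width H =
     (LEAST w. \<exists>N E B. tree_decomposition H N E B \<and> decomposition_width N B = w)"

definition underlying :: "('x, 'a) query \<Rightarrow> 'x multigraph" where
  "underlying \<gamma> = \<lparr> mverts = vars \<gamma>,
     medges = image_mset (\<lambda>(x, L, y). {x, y}) (mset (atoms \<gamma>)) \<rparr>"

text \<open>The maximum over the empty union is \<open>0\<close>.\<close>

definition union_tree_width :: "('x, 'a) query set \<Rightarrow> nat" where
  "union_tree_width \<Gamma> = Max (insert 0 ((\<lambda>\<gamma>. tree_width (underlying \<gamma>)) ` \<Gamma>))"

text \<open>The equivalent query may use any finite number of variables, drawn from the natural
  numbers.\<close>

definition semantic_tw_at_most :: "nat \<Rightarrow> nat \<Rightarrow> (nat, 'a) query set \<Rightarrow> bool" where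
  "semantic_tw_at_most k n \<Gamma> \<longleftrightarrow>
     (\<exists>\<Delta> :: (nat, 'a) query set. uc2rpq n \<Delta> \<and> equivalent \<Gamma> \<Delta> \<and> union_tree_width \<Delta> \<le> k)"

definition one_way_semantic_tw_at_most :: "nat \<Rightarrow> nat \<Rightarrow> (nat, 'a) query set \<Rightarrow> bool" where
  "one_way_semantic_tw_at_most k n \<Gamma> \<longleftrightarrow>
     (\<exists>\<Delta> :: (nat, 'a) query set. ucrpq n \<Delta> \<and> equivalent \<Gamma> \<Delta> \<and> union_tree_width \<Delta> \<le> k)"

end

theory Submission
  imports Defs
begin

text \<open>A database satisfying a UC2RPQ of tree-width at most \<open>k\<close> receives a homomorphism from an expansion
  \<open>D\<close> of one of its members, and since \<open>k \<ge> 2\<close> the graph \<open>D\<close> has tree-width at most \<open>k\<close> too. By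
  equivalence \<open>D\<close> satisfies a member \<open>\<gamma>\<close> of the UCRPQ: its atoms become walks in \<open>D\<close> labelled by one-way
  words, whose positions carry states of the automata of \<open>\<gamma>\<close>. Dropping positions of the walks merges
  consecutive labels, so every system of walks obtained that way still describes a refinement of \<open>\<gamma>\<close>
  that holds in \<open>D\<close>. It remains to drop positions, keeping the tree-width, until only boundedly many
  vertices are used. On a long branch of the decomposition two separators have the same special vertices
  behind them and the same coincidences among the last visits of the walks; the part between them can be
  replaced by direct links between these last visits. Boundedly many vertices and the finitely many
  languages between two automaton states leave finitely many candidate CRPQs, and the union of those that
  have tree-width at most \<open>k\<close> and are contained in the given query is equivalent to it.\<close>

section \<open>Perfect elimination orderings\<close>

text \<open>Dropping positions of a walk creates an edge between vertices that may have been far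
  apart, and the edges created for all walks together must not raise the tree-width. A detour that
  leaves and re-enters a region through a clique is harmless, since its two ends are adjacent
  already. The hard case is a walk that crosses from one separator to another: its last visits to
  the two get paired, and some bag must contain each pair. When the vertices of one separator are
  exchanged for those of the other one at a time, a bag has to retain every old end whose partner is
  still to come. It stays small because equal new ends have equal old ends, so that the retained
  vertices are counted by the missing partners. Hence two separators need to agree only in which
  walks coincide there, and the number of such patterns is bounded in terms of the number of atoms,
  whatever the database. Elimination orderings suit this better than tree decompositions: size is
  measured in vertices, and each vertex \<open>t\<close> brings its own separator
  \<open>A t\<close>.\<close>

text \<open>A graph has tree-width at most \<open>k\<close> iff it is a subgraph of a chordal graph without cliques of
  more than \<open>k + 1\<close> vertices. The chordal graph is given by a perfect elimination ordering: the vertices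
  are numbers, and the neighbours of \<open>v\<close> below \<open>v\<close> form the clique \<open>A v\<close>. The sets \<open>insert v (A v)\<close>
  are the bags of a tree decomposition.\<close>

locale peo =
  fixes k :: nat and V :: "nat set" and A :: "nat \<Rightarrow> nat set"
  assumes finV: "finite V"
    and below: "v \<in> V \<Longrightarrow> u \<in> A v \<Longrightarrow> u \<in> V \<and> u < v"
    and card_le: "v \<in> V \<Longrightarrow> card (A v) \<le> k"
    and clique: "v \<in> V \<Longrightarrow> u \<in> A v \<Longrightarrow> w \<in> A v \<Longrightarrow> u < w \<Longrightarrow> u \<in> A w"

text \<open>Equality is included so that loops are covered and adjacency survives the identification
  of two vertices.\<close>

definition nbr :: "(nat \<Rightarrow> nat set) \<Rightarrow> nat \<Rightarrow> nat \<Rightarrow> bool" where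
  "nbr A u v \<longleftrightarrow> u = v \<or> u \<in> A v \<or> v \<in> A u"

lemma nbr_sym: "nbr A u v \<Longrightarrow> nbr A v u"
  by (auto simp: nbr_def)

definition step ::
  "nat set \<Rightarrow> (nat \<Rightarrow> nat set) \<Rightarrow> (nat \<times> 's \<Rightarrow> nat \<times> 's \<Rightarrow> bool) \<Rightarrow> nat \<times> 's \<Rightarrow> nat \<times> 's \<Rightarrow> bool" where
  "step V A P e e' \<longleftrightarrow> fst e \<in> V \<and> fst e' \<in> V \<and> nbr A (fst e) (fst e') \<and> P e e'"

lemma chain_transp:
  assumes "transp P" and "\<And>i. i < r \<Longrightarrow> P (p i) (p (Suc i))" and "i < j" "j \<le> r"
  shows "P (p i) (p j)"
  using assms(3,4)
proof (induction j)
  case (Suc j)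
  have "P (p j) (p (Suc j))" using assms(2) Suc.prems by simp
  then show ?case
    using Suc assms(1) by (cases "i = j") (auto dest: transpD)
qed simp

text \<open>Each excursion out of \<open>C\<close> leaves and returns through the clique \<open>B\<close> and can be cut short there.\<close>
lemma region_walk:
  assumes "transp P" and walk: "\<And>i. i < r \<Longrightarrow> step V A P (p i) (p (Suc i))"
    and "C \<subseteq> V'" "B \<subseteq> C"
    and leave: "\<And>u v. u \<in> C \<Longrightarrow> v \<in> V - C \<Longrightarrow> nbr A u v \<Longrightarrow> u \<in> B"
    and Bclique: "\<And>u v. u \<in> B \<Longrightarrow> v \<in> B \<Longrightarrow> nbr A' u v"
    and keep: "\<And>u v. u \<in> C \<Longrightarrow> v \<in> C \<Longrightarrow> nbr A u v \<Longrightarrow> nbr A' u v"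
    and "i \<le> j" "j \<le> r" "fst (p i) \<in> C" "fst (p j) \<in> C"
  shows "(step V' A' P)\<^sup>*\<^sup>* (p i) (p j)"
proof -
  have P: "P (p a) (p b)" if "a < b" "b \<le> r" for a b
    using chain_transp[OF assms(1), of r p a b] walk that by (auto simp: step_def)
  \<comment> \<open>Invariant: inside \<open>C\<close> the shortened walk is up to date; outside it
    waits at an earlier position over the clique \<open>B\<close>, through which \<open>C\<close>
    was left.\<close>
  have "if fst (p j) \<in> C then (step V' A' P)\<^sup>*\<^sup>* (p i) (p j)
    else \<exists>l \<le> j. fst (p l) \<in> B \<and> (step V' A' P)\<^sup>*\<^sup>* (p i) (p l)"
    using \<open>i \<le> j\<close> \<open>j \<le> r\<close>
  proof (induction j rule: dec_induct)
    case base
    then show ?case using assms(10) by simp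
  next
    case (step j)
    have s: "fst (p j) \<in> V" "fst (p (Suc j)) \<in> V" "nbr A (fst (p j)) (fst (p (Suc j)))"
      using walk[of j] step.prems by (auto simp: step_def)
    show ?case
    proof (cases "fst (p j) \<in> C")
      case True
      then have IH: "(step V' A' P)\<^sup>*\<^sup>* (p i) (p j)" using step by simp
      show ?thesis
      proof (cases "fst (p (Suc j)) \<in> C")
        case in_C: True
        then have "step V' A' P (p j) (p (Suc j))"
          using True s P[of j "Suc j"] step.prems keep \<open>C \<subseteq> V'\<close> by (auto simp: step_def)
        then show ?thesis using IH in_C by (simp add: rtranclp.rtrancl_into_rtrancl)
      next
        case False
        then have "fst (p j) \<in> B" using leave True s by blast
        then show ?thesis using IH False by (auto intro: exI[of _ j])
      qed
    next
      case False
      then obtain l where l: "l \<le> j" "fst (p l) \<in> B" "(step V' A' P)\<^sup>*\<^sup>* (p i) (p l)"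
        using step by auto
      show ?thesis
      proof (cases "fst (p (Suc j)) \<in> C")
        case in_C: True
        then have "fst (p (Suc j)) \<in> B" using leave False s nbr_sym by blast
        \<comment> \<open>Both ends lie in \<open>B\<close> and hence are adjacent; transitivity of
          \<open>P\<close> bridges the skipped positions.\<close>
        then have "step V' A' P (p l) (p (Suc j))"
          using l P[of l "Suc j"] step.prems Bclique \<open>C \<subseteq> V'\<close> \<open>B \<subseteq> C\<close>
          by (auto simp: step_def)
        then show ?thesis using l in_C by (simp add: rtranclp.rtrancl_into_rtrancl)
      next
        case notin: False
        then show ?thesis using l by (auto intro!: exI[of _ l])
      qed
    qed
  qed
  then show ?thesis using assms(11) by simp
qed

section \<open>Subtrees of an elimination ordering and their separators\<close>

context peo
begin

definition par :: "nat \<Rightarrow> nat \<Rightarrow> bool" where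
  "par u v \<longleftrightarrow> v \<in> V \<and> u \<in> A v"

text \<open>The subtree of \<open>t\<close> in the elimination forest, where the parent of
  \<open>v\<close> is \<open>Max (A v)\<close>: as \<open>A v\<close> is a clique, iterating all
  lower neighbours reaches the same vertices as iterating that parent.\<close>

definition desc :: "nat \<Rightarrow> nat set" where
  "desc t = {v. par\<^sup>*\<^sup>* t v}"

lemma finA: "v \<in> V \<Longrightarrow> finite (A v)"
  using below finV by (meson finite_subset subsetI)

lemma par_le: "par\<^sup>*\<^sup>* u v \<Longrightarrow> u \<le> v"
proof (induction rule: rtranclp_induct)
  case (step v w)
  then show ?case using below[of w v] by (simp add: par_def)
qed simp

lemma desc_V: "v \<in> desc t \<Longrightarrow> t \<in> V \<Longrightarrow> v \<in> V"
  unfolding desc_def mem_Collect_eq by (induction rule: rtranclp_induct) (auto simp: par_def)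

lemma desc_refl: "t \<in> desc t"
  by (simp add: desc_def)

lemma desc_step: "u \<in> desc t \<Longrightarrow> v \<in> V \<Longrightarrow> u \<in> A v \<Longrightarrow> v \<in> desc t"
  by (auto simp: desc_def par_def intro: rtranclp.rtrancl_into_rtrancl)

text \<open>Along a chain from \<open>t\<close> to \<open>v\<close>, the clique condition passes a
  lower neighbour of \<open>v\<close> on to the preceding vertex of the chain if it is smaller than
  that vertex, and places it in the subtree if it is larger. What is passed all the way down lies in
  \<open>A t\<close>.\<close>

lemma desc_anc:
  assumes "t \<in> V" "v \<in> desc t" "u \<in> A v"
  shows "u \<in> desc t \<or> u \<in> A t"
proof -
  have "par\<^sup>*\<^sup>* t v" using assms(2) by (simp add: desc_def)
  then show ?thesis using assms(3)
  proof (induction arbitrary: u rule: rtranclp_induct)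
    case (step w v)
    then have v: "v \<in> V" "w \<in> A v" "u \<in> A v" by (auto simp: par_def)
    consider "u = w" | "u < w" | "w < u" by linarith
    then show ?case
    proof cases
      case 1
      then show ?thesis using step by (simp add: desc_def)
    next
      case 2
      then show ?thesis using clique[OF v(1) v(3) v(2)] step.IH by blast
    next
      case 3
      then have "w \<in> A u" using clique v by blast
      moreover have "w \<in> desc t" using step by (simp add: desc_def)
      ultimately show ?thesis using below v desc_step by blast
    qed
  qed simp
qed

lemma desc_exit:
  assumes "t \<in> V" "v \<in> desc t" "u \<in> V" "u \<notin> desc t" "nbr A u v"
  shows "u \<in> A t"
  using assms desc_anc desc_step[OF assms(2,3)] by (auto simp: nbr_def)

lemma A_notin_desc: "t \<in> V \<Longrightarrow> u \<in> A t \<Longrightarrow> u \<notin> desc t"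
  using par_le[of t u] below[of t u] by (auto simp: desc_def)

lemma A_nbr: "v \<in> V \<Longrightarrow> u \<in> A v \<Longrightarrow> w \<in> A v \<Longrightarrow> nbr A u w"
  using clique[of v u w] clique[of v w u] unfolding nbr_def by (cases u w rule: linorder_cases) auto

text \<open>The ancestors of \<open>v\<close> form a chain. On the way from \<open>v\<close> down to
  \<open>s\<close>, the subtree of \<open>t\<close> can be left only through \<open>A t\<close>, and
  from there on all vertices are ancestors of \<open>t\<close>. If it is never left, then
  \<open>s \<le> t\<close> forces \<open>s = t\<close>.\<close>

lemma par_chain:
  assumes "v \<in> V" "par\<^sup>*\<^sup>* s v" "par\<^sup>*\<^sup>* t v" "s \<le> t" "t \<in> V"
  shows "par\<^sup>*\<^sup>* s t"
proof -
  have "par\<^sup>*\<^sup>* s v \<Longrightarrow> par\<^sup>*\<^sup>* s t \<or> s \<in> desc t"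
    using assms(2)
  proof (induction rule: converse_rtranclp_induct)
    case base
    then show ?case using assms(3) by (simp add: desc_def)
  next
    case (step s u)
    then consider "par\<^sup>*\<^sup>* u t" | "u \<in> desc t" by blast
    then show ?case
    proof cases
      case 1
      then show ?thesis using step by (auto intro: converse_rtranclp_into_rtranclp)
    next
      case 2
      then have "s \<in> desc t \<or> s \<in> A t" using step desc_anc[OF assms(5)] by (auto simp: par_def)
      then show ?thesis using assms(5) by (auto simp: par_def)
    qed
  qed
  moreover have "s = t" if "s \<in> desc t" using that par_le assms(4) by (fastforce simp: desc_def)
  ultimately show ?thesis using assms(2) by auto
qed

end

section \<open>Contracting the part between two separators\<close>

text \<open>A walk segment between the separators \<open>A s\<close> and \<open>A t\<close> is replaced by an edge between its last
  visits \<open>b j\<close> and \<open>c j\<close>; these edges are realised by exchanging the vertices of \<open>A s\<close> for those of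
  \<open>A t\<close> one at a time.\<close>

locale contraction = peo +
  fixes s t :: nat and J :: "'j set" and b c :: "'j \<Rightarrow> nat"
  assumes sV: "s \<in> V" and tV: "t \<in> V" and st: "t \<in> desc s" and s_notin: "s \<notin> A t" and neq: "s \<noteq> t"
    and pattern: "\<And>i j. i \<in> J \<Longrightarrow> j \<in> J \<Longrightarrow> c i = c j \<Longrightarrow> b i = b j"
begin

text \<open>The old ends that must still be present when \<open>v\<close> is introduced:
  \<open>b j\<close> is released only after its partner \<open>c j\<close>, and the case
  \<open>v = c j\<close> makes the link itself an edge. Partners in \<open>A s\<close> need no link,
  since a walk can change sides at a vertex common to both separators.\<close>

definition link :: "nat \<Rightarrow> nat set" where
  "link v = {b j | j. j \<in> J \<and> b j \<in> A s \<and> c j \<in> A t - A s \<and> v \<le> c j}"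

definition V' :: "nat set" where
  "V' = (V - desc s) \<union> A t \<union> desc t"

text \<open>Old edges are preserved within the outer side \<open>V - desc s\<close> and within the
  inner side \<open>A t \<union> desc t\<close>. An old edge between the separators may vanish,
  because walks will cross only at common vertices or along links.\<close>

definition A' :: "nat \<Rightarrow> nat set" where
  "A' v = (if v \<in> A t - A s then (A s \<inter> A t) \<union> {u \<in> A t - A s. u < v} \<union> link v else A v)"

lemma At_cases: "u \<in> A t \<Longrightarrow> u \<in> desc s \<or> u \<in> A s"
  using desc_anc[OF sV st] .

lemma desc_ts: "desc t \<subseteq> desc s"
  using st by (auto simp: desc_def)

lemma s_ge: "v \<in> desc s \<Longrightarrow> s \<le> v"
  using par_le by (simp add: desc_def)

text \<open>The vertices of \<open>link v\<close> are determined by those of \<open>A t - A s\<close> not yet introduced, so that \<open>A' v\<close>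
  is no larger than \<open>A t\<close>.\<close>
lemma card_A': "v \<in> A t - A s \<Longrightarrow> card (A' v) \<le> k"
proof -
  assume v: "v \<in> A t - A s"
  \<comment> \<open>By \<open>pattern\<close>, \<open>b j\<close> is a function of
    \<open>c j\<close>; this is that function.\<close>
  define g where "g x = b (SOME j. j \<in> J \<and> c j = x)" for x
  have g: "g (c j) = b j" if "j \<in> J" for j
  proof -
    have "(SOME i. i \<in> J \<and> c i = c j) \<in> J \<and> c (SOME i. i \<in> J \<and> c i = c j) = c j"
      using that by (intro someI_ex[of "\<lambda>i. i \<in> J \<and> c i = c j"]) auto
    then show ?thesis using that pattern unfolding g_def by blast
  qed
  have fin: "finite (A t)" using finA tV .
  have "link v \<subseteq> g ` {u \<in> A t - A s. v \<le> u}" (is "_ \<subseteq> g ` ?H")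
    using g by (force simp: link_def)
  then have "card (link v) \<le> card ?H"
    using fin by (intro order.trans[OF card_mono card_image_le]) auto
  then have "card (A' v) \<le> card (A s \<inter> A t) + card {u \<in> A t - A s. u < v} + card ?H"
    using v card_Un_le[of "(A s \<inter> A t) \<union> {u \<in> A t - A s. u < v}" "link v"]
      card_Un_le[of "A s \<inter> A t" "{u \<in> A t - A s. u < v}"]
    unfolding A'_def by simp
  also have "\<dots> = card ((A s \<inter> A t) \<union> {u \<in> A t - A s. u < v} \<union> ?H)"
    using fin by (subst card_Un_disjoint; (subst card_Un_disjoint)?) auto
  also have "\<dots> \<le> card (A t)" using fin by (intro card_mono) auto
  finally show ?thesis using card_le tV le_trans by blast
qed

lemma V'_V: "V' \<subseteq> V"
  using below tV desc_V by (auto simp: V'_def)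

text \<open>The vertex \<open>s\<close> itself disappears: it lies in \<open>desc s\<close>, but
  neither in \<open>A t\<close> nor, being smaller than \<open>t\<close>, in
  \<open>desc t\<close>.\<close>

lemma V'_card: "card V' < card V"
proof -
  have "s \<notin> desc t" using par_le[of t s] s_ge[OF st] neq by (auto simp: desc_def)
  then have "s \<notin> V'" using s_notin by (simp add: V'_def desc_refl)
  then show ?thesis using V'_V sV finV by (metis psubsetI psubset_card_mono)
qed

lemma A'_other: "v \<notin> A t - A s \<Longrightarrow> A' v = A v"
  by (auto simp: A'_def)

lemma A'_left: "v \<in> V - desc s \<Longrightarrow> A' v = A v"
  using At_cases by (auto simp: A'_def)

lemma A'_right: "v \<in> desc t \<Longrightarrow> A' v = A v"
  using A_notin_desc tV by (auto simp: A'_def)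

lemma As_left: "A s \<subseteq> V - desc s"
  using below sV A_notin_desc by blast

lemma A'_below:
  assumes "v \<in> V'" "u \<in> A' v"
  shows "u \<in> V' \<and> u < v"
proof -
  consider "v \<in> V - desc s" | "v \<in> desc t" | "v \<in> A t - A s"
    using assms(1) At_cases As_left by (auto simp: V'_def)
  then show ?thesis
  proof cases
    case 1
    then have "u \<in> A v" using assms A'_left by simp
    then have "u \<notin> desc s" using 1 desc_step by blast
    then show ?thesis using \<open>u \<in> A v\<close> 1 below by (auto simp: V'_def)
  next
    case 2
    then have "u \<in> A v" using assms A'_right by simp
    then show ?thesis using desc_anc[OF tV 2, of u] below[of v u] desc_V[OF 2 tV] by (auto simp: V'_def)
  next
    case 3
    then have "v \<in> desc s" using At_cases by blast
    then have "x < v" if "x \<in> A s" for x using s_ge below[OF sV that] by fastforce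
    then show ?thesis using 3 assms As_left by (auto simp: A'_def link_def V'_def)
  qed
qed

text \<open>The new case is a vertex \<open>v\<close> of \<open>A t - A s\<close>. All of
  \<open>A s\<close> precedes \<open>A t - A s\<close>, which lies in \<open>desc s\<close>, and
  \<open>link\<close> shrinks as its argument grows, so a smaller vertex of \<open>A t - A s\<close>
  has every old end that \<open>v\<close> retains.\<close>

lemma A'_clique:
  assumes "v \<in> V'" "u \<in> A' v" "w \<in> A' v" "u < w"
  shows "u \<in> A' w"
proof -
  consider "v \<in> V - desc s" | "v \<in> desc t" | "v \<in> A t - A s"
    using assms(1) At_cases As_left by (auto simp: V'_def)
  then show ?thesis
  proof cases
    case 1
    then have "u \<in> A v" "w \<in> A v" using assms A'_left by auto
    moreover have "w \<in> V - desc s" using \<open>w \<in> A v\<close> 1 desc_step below by blast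
    ultimately show ?thesis using 1 assms(4) A'_left clique[of v u w] by auto
  next
    case 2
    then have uw: "u \<in> A v" "w \<in> A v" "v \<in> V" using assms A'_right desc_V tV by auto
    then have "u \<in> A w" using clique[of v u w] assms(4) by blast
    show ?thesis
    proof (cases "w \<in> A t - A s")
      case True
      then have "w \<notin> desc t" using A_notin_desc tV by blast
      then have "u \<notin> desc t" using \<open>u \<in> A w\<close> desc_step uw below by blast
      then have "u \<in> A t" using desc_anc[OF tV 2] uw by blast
      then show ?thesis using True assms by (auto simp: A'_def)
    qed (use \<open>u \<in> A w\<close> A'_other in blast)
  next
    case 3
    have lo: "x < y" if "x \<in> A s" "y \<in> A t - A s" for x y
      using that At_cases s_ge below[OF sV that(1)] by fastforce
    have Asc: "x \<in> A y" if "x \<in> A s" "y \<in> A s" "x < y" for x y using that clique sV by blast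
    have ls: "link v \<subseteq> A s" for v by (auto simp: link_def)
    show ?thesis
    proof (cases "w \<in> A t - A s")
      case True
      then have "w < v" using 3 assms ls by (auto simp: A'_def)
      then have "link v \<subseteq> link w" by (force simp: link_def)
      then show ?thesis using 3 True assms by (auto simp: A'_def)
    next
      case False
      then have "w \<in> A s" using 3 assms ls by (auto simp: A'_def)
      then have "u \<in> A s" using 3 assms ls lo[of w u] by (auto simp: A'_def)
      then show ?thesis using False A'_other Asc \<open>w \<in> A s\<close> assms by blast
    qed
  qed
qed

lemma peo': "peo k V' A'"
proof
  show "finite V'" using V'_V finV finite_subset by blast
  show "card (A' v) \<le> k" if "v \<in> V'" for v
    using that V'_V card_A' card_le[of v] by (cases "v \<in> A t - A s") (auto simp: A'_def)
qed (use A'_below A'_clique in blast)+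

lemma nbr_left:
  assumes "u \<in> V - desc s" "v \<in> V - desc s" "nbr A u v"
  shows "nbr A' u v"
  using assms A'_left by (simp add: nbr_def)

lemma nbr_right:
  assumes "u \<in> A t \<union> desc t" "v \<in> A t \<union> desc t" "nbr A u v"
  shows "nbr A' u v"
proof -
  have "x \<in> A' y" if x: "x \<in> A t \<union> desc t" "y \<in> A t \<union> desc t" "x \<in> A y" for x y
  proof (cases "y \<in> A t - A s")
    case True
    then have "y \<in> V" "y \<notin> desc t" using below tV A_notin_desc by blast+
    then have "x \<in> A t" "x < y" using x desc_step[of x t y] below by auto
    then show ?thesis using True by (auto simp: A'_def)
  next
    case False
    then show ?thesis using x A'_other by blast
  qed
  then show ?thesis using assms by (auto simp: nbr_def)
qed

lemma nbr_link:
  assumes "j \<in> J" "b j \<in> A s" "c j \<in> A t - A s"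
  shows "nbr A' (b j) (c j)"
  using assms by (auto simp: nbr_def A'_def link_def)

section \<open>Walks in the contracted graph\<close>

lemma left_walk:
  assumes "transp P" "\<And>i. i < r \<Longrightarrow> step V A P (p i) (p (Suc i))" "i \<le> j" "j \<le> r"
    "fst (p i) \<in> V - desc s" "fst (p j) \<in> V - desc s"
  shows "(step V' A' P)\<^sup>*\<^sup>* (p i) (p j)"
proof (rule region_walk[where C = "V - desc s" and B = "A s"])
  show "u \<in> A s" if "u \<in> V - desc s" "v \<in> V - (V - desc s)" "nbr A u v" for u v
    using that desc_exit[OF sV, of v u] by blast
  show "nbr A' u v" if "u \<in> A s" "v \<in> A s" for u v
    using that nbr_left As_left A_nbr sV by blast
qed (use assms nbr_left As_left in \<open>auto simp: V'_def\<close>)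

lemma right_walk:
  assumes "transp P" "\<And>i. i < r \<Longrightarrow> step V A P (p i) (p (Suc i))" "i \<le> j" "j \<le> r"
    "fst (p i) \<in> A t \<union> desc t" "fst (p j) \<in> A t \<union> desc t"
  shows "(step V' A' P)\<^sup>*\<^sup>* (p i) (p j)"
proof (rule region_walk[where C = "A t \<union> desc t" and B = "A t"])
  show "u \<in> A t" if "u \<in> A t \<union> desc t" "v \<in> V - (A t \<union> desc t)" "nbr A u v" for u v
    using that desc_exit[OF tV, of u v] nbr_sym by blast
  show "nbr A' u v" if "u \<in> A t" "v \<in> A t" for u v
    using that nbr_right A_nbr tV by blast
qed (use assms nbr_right in \<open>auto simp: V'_def\<close>)

end

text \<open>The index is unspecified if the walk never meets \<open>X\<close>. This does no harm:
  such values only have to respect the coincidence pattern, and a link is taken only by a walk that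
  has been shown to visit both separators.\<close>

definition last_visit :: "(nat \<Rightarrow> nat \<times> 's) \<Rightarrow> nat \<Rightarrow> nat set \<Rightarrow> nat" where
  "last_visit p r X = (GREATEST i. i \<le> r \<and> fst (p i) \<in> X)"

lemma last_visit:
  assumes "i \<le> r" "fst (p i) \<in> X"
  shows "i \<le> last_visit p r X" "last_visit p r X \<le> r" "fst (p (last_visit p r X)) \<in> X"
proof -
  have 1: "i \<le> r \<and> fst (p i) \<in> X" using assms by simp
  have 2: "\<And>y. y \<le> r \<and> fst (p y) \<in> X \<Longrightarrow> y \<le> r" by simp
  show "i \<le> last_visit p r X" unfolding last_visit_def
    using Greatest_le_nat[of "\<lambda>i. i \<le> r \<and> fst (p i) \<in> X", OF 1 2] .
  show "last_visit p r X \<le> r" "fst (p (last_visit p r X)) \<in> X" unfolding last_visit_def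
    using GreatestI_nat[of "\<lambda>i. i \<le> r \<and> fst (p i) \<in> X", OF 1 2] by auto
qed

lemma crossing:
  assumes "i \<le> j" "Q i" "\<not> Q j"
  obtains l where "i \<le> l" "l < j" "Q l" "\<not> Q (Suc l)"
proof -
  have "\<exists>l. i \<le> l \<and> l < j \<and> Q l \<and> \<not> Q (Suc l)"
    using assms
  proof (induction j rule: dec_induct)
    case (step j)
    then show ?case by (cases "Q j") (auto intro: less_SucI)
  qed simp
  then show ?thesis using that by blast
qed

text \<open>A walk with both ends on one side is cut short within that side. A walk that changes
  sides does so at a common vertex of the separators or else along its link: going inwards, it must
  meet \<open>A t\<close> after its last visit to \<open>A s\<close>; going outwards, it must meet
  \<open>A s\<close> after its last visit to \<open>A t\<close>. Thus last visits serve both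
  directions.\<close>

lemma (in contraction) contract_walk:
  assumes tr: "transp P" and walk: "\<And>i. i < r \<Longrightarrow> step V A P (p i) (p (Suc i))"
    and "j \<in> J" and bj: "b j = fst (p (last_visit p r (A s)))"
    and cj: "c j = fst (p (last_visit p r (A t)))"
    and ends: "fst (p 0) \<in> (V - desc s) \<union> desc t" "fst (p r) \<in> (V - desc s) \<union> desc t"
  shows "(step V' A' P)\<^sup>*\<^sup>* (p 0) (p r)"
proof -
  let ?f = "\<lambda>i. fst (p i)"
  let ?S = "last_visit p r (A s)" and ?T = "last_visit p r (A t)"
  have fV: "?f i \<in> V" if "i \<le> r" "0 < r" for i
    using walk[of i] walk[of "i - 1"] that by (cases i) (auto simp: step_def)
  have nb: "nbr A (?f i) (?f (Suc i))" "nbr A (?f (Suc i)) (?f i)" if "i < r" for i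
    using walk[OF that] nbr_sym by (auto simp: step_def)
  note L = left_walk[where p = p and r = r, OF tr walk] and R = right_walk[where p = p and r = r, OF tr walk]
  have Pst: "P (p i) (p i')" if "i < i'" "i' \<le> r" for i i'
    using chain_transp[OF tr, of r p] walk that by (auto simp: step_def)
  consider (LL) "?f 0 \<in> V - desc s" "?f r \<in> V - desc s" | (RR) "?f 0 \<in> desc t" "?f r \<in> desc t"
    | (LR) "?f 0 \<in> V - desc s" "?f r \<in> desc t" | (RL) "?f 0 \<in> desc t" "?f r \<in> V - desc s"
    using ends by blast
  then show ?thesis
  proof cases
    case LL
    then show ?thesis using L[of 0 r] by simp
  next
    case RR
    then show ?thesis using R[of 0 r] by simp
  next
    case LR
    then have r: "0 < r" using desc_ts by (cases r) auto
    show ?thesis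
    proof (cases "\<exists>i\<le>r. ?f i \<in> A s \<inter> A t")
      case True
      then obtain i where i: "i \<le> r" "?f i \<in> A s \<inter> A t" by blast
      have "(step V' A' P)\<^sup>*\<^sup>* (p 0) (p i)" using L[of 0 i] i LR As_left by auto
      moreover have "(step V' A' P)\<^sup>*\<^sup>* (p i) (p r)" using R[of i r] i LR by auto
      ultimately show ?thesis by simp
    next
      case False
      obtain l where l: "l < r" "?f l \<notin> desc s" "?f (Suc l) \<in> desc s"
        using crossing[of 0 r "\<lambda>i. ?f i \<notin> desc s"] LR desc_ts by blast
      then have "?f l \<in> A s" using desc_exit[OF sV, of "?f (Suc l)" "?f l"] fV nb r by simp
      then have S: "?S \<le> r" "?f ?S \<in> A s" using l last_visit[of l r p "A s"] by auto
      then have "?f ?S \<notin> desc t" using As_left desc_ts by blast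
      then obtain l' where l': "?S \<le> l'" "l' < r" "?f l' \<notin> desc t" "?f (Suc l') \<in> desc t"
        using crossing[of ?S r "\<lambda>i. ?f i \<notin> desc t"] LR S by blast
      then have "?f l' \<in> A t" using desc_exit[OF tV, of "?f (Suc l')" "?f l'"] fV nb r by simp
      then have T: "l' \<le> ?T" "?T \<le> r" "?f ?T \<in> A t" using l' last_visit[of l' r p "A t"] by auto
      have "?S \<noteq> ?T" using False S T by force
      then have "?S < ?T" using l' T by simp
      have "?f ?T \<notin> A s" using False T by blast
      then have "nbr A' (?f ?S) (?f ?T)"
        using nbr_link[OF \<open>j \<in> J\<close>] bj cj S T by simp
      then have "step V' A' P (p ?S) (p ?T)"
        using Pst[OF \<open>?S < ?T\<close>] S T As_left by (auto simp: step_def V'_def)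
      moreover have "(step V' A' P)\<^sup>*\<^sup>* (p 0) (p ?S)" using L[of 0 ?S] S LR As_left by auto
      moreover have "(step V' A' P)\<^sup>*\<^sup>* (p ?T) (p r)" using R[of ?T r] T LR by auto
      ultimately show ?thesis by (meson rtranclp.rtrancl_into_rtrancl rtranclp_trans)
    qed
  next
    case RL
    then have r: "0 < r" using desc_ts by (cases r) auto
    show ?thesis
    proof (cases "\<exists>i\<le>r. ?f i \<in> A s \<inter> A t")
      case True
      then obtain i where i: "i \<le> r" "?f i \<in> A s \<inter> A t" by blast
      have "(step V' A' P)\<^sup>*\<^sup>* (p 0) (p i)" using R[of 0 i] i RL by auto
      moreover have "(step V' A' P)\<^sup>*\<^sup>* (p i) (p r)" using L[of i r] i RL As_left by auto
      ultimately show ?thesis by simp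
    next
      case False
      obtain l where l: "l < r" "?f l \<in> desc t" "?f (Suc l) \<notin> desc t"
        using crossing[of 0 r "\<lambda>i. ?f i \<in> desc t"] RL desc_ts by blast
      then have "?f (Suc l) \<in> A t" using desc_exit[OF tV, of "?f l" "?f (Suc l)"] fV nb r by simp
      then have T: "?T \<le> r" "?f ?T \<in> A t" using l last_visit[of "Suc l" r p "A t"] by auto
      then have nS: "?f ?T \<notin> A s" using False by blast
      then have "?f ?T \<in> desc s" using T At_cases by blast
      then obtain l' where l': "?T \<le> l'" "l' < r" "?f l' \<in> desc s" "?f (Suc l') \<notin> desc s"
        using crossing[of ?T r "\<lambda>i. ?f i \<in> desc s"] RL T by blast
      then have "?f (Suc l') \<in> A s" using desc_exit[OF sV, of "?f l'" "?f (Suc l')"] fV nb r by simp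
      then have S: "Suc l' \<le> ?S" "?S \<le> r" "?f ?S \<in> A s"
        using l' last_visit[of "Suc l'" r p "A s"] by auto
      have "?T < ?S" using l' S by simp
      have "nbr A' (?f ?T) (?f ?S)"
        using nbr_sym nbr_link[OF \<open>j \<in> J\<close>] bj cj S T nS by simp
      then have "step V' A' P (p ?T) (p ?S)"
        using Pst[OF \<open>?T < ?S\<close>] S T As_left by (auto simp: step_def V'_def)
      moreover have "(step V' A' P)\<^sup>*\<^sup>* (p 0) (p ?T)" using R[of 0 ?T] T RL by auto
      moreover have "(step V' A' P)\<^sup>*\<^sup>* (p ?S) (p r)" using L[of ?S r] S RL As_left by auto
      ultimately show ?thesis by (meson rtranclp.rtrancl_into_rtrancl rtranclp_trans)
    qed
  qed
qed

section \<open>Walk systems on boundedly many vertices\<close>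

lemma rtranclp_seq:
  assumes "R\<^sup>*\<^sup>* x y"
  obtains p :: "nat \<Rightarrow> 'a" and r where "p 0 = x" "p r = y" "\<And>i. i < r \<Longrightarrow> R (p i) (p (Suc i))"
  using rtranclp_imp_relpowp[OF assms] by (auto simp: relpowp_fun_conv)

lemma large_fibre:
  assumes "finite Y" "f ` X \<subseteq> Y" "n * card Y < card X"
  obtains y where "y \<in> Y" "n < card {x \<in> X. f x = y}"
proof -
  have "\<exists>y\<in>Y. n < card {x \<in> X. f x = y}"
  proof (rule ccontr)
    assume "\<not> ?thesis"
    then have "(\<Sum>y\<in>Y. card {x \<in> X. f x = y}) \<le> card Y * n"
      using sum_bounded_above[of Y "\<lambda>y. card {x \<in> X. f x = y}" n] by (simp add: not_less)
    moreover have "X = (\<Union>y\<in>Y. {x \<in> X. f x = y})" using assms(2) by auto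
    then have "card X \<le> (\<Sum>y\<in>Y. card {x \<in> X. f x = y})"
      using card_UN_le[OF assms(1)] by metis
    ultimately show False using assms(3) by (simp add: mult.commute)
  qed
  then show ?thesis using that by blast
qed

section \<open>Leaves and long chains of ancestors\<close>

context peo
begin

lemma remove_leaf:
  assumes "v \<in> V" "\<And>w. w \<in> V \<Longrightarrow> v \<notin> A w"
  shows "peo k (V - {v}) A"
proof
  show "u \<in> V - {v} \<and> u < w" if "w \<in> V - {v}" "u \<in> A w" for u w
    using assms(2)[of w] below[of w u] that by auto
qed (use finV card_le clique in auto)

text \<open>A vertex \<open>v\<close> that is in no \<open>A w\<close> has all its neighbours in the
  clique \<open>A v\<close>, so a walk can bypass it.\<close>

lemma remove_leaf_walk:
  assumes "v \<in> V" "\<And>w. w \<in> V \<Longrightarrow> v \<notin> A w" "transp P"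
    and "(step V A P)\<^sup>*\<^sup>* x y" "fst x \<in> V - {v}" "fst y \<in> V - {v}"
  shows "(step (V - {v}) A P)\<^sup>*\<^sup>* x y"
proof -
  obtain p r where p: "p 0 = x" "p r = y" "\<And>i. i < r \<Longrightarrow> step V A P (p i) (p (Suc i))"
    using rtranclp_seq[OF assms(4)] by blast
  have "(step (V - {v}) A P)\<^sup>*\<^sup>* (p 0) (p r)"
  proof (rule region_walk[where C = "V - {v}" and B = "A v"])
    show "step V A P (p i) (p (Suc i))" if "i < r" for i by (rule p(3)[OF that])
    show "nbr A u w" if "u \<in> A v" "w \<in> A v" for u w by (rule A_nbr[OF assms(1) that])
    show "u \<in> A v" if "u \<in> V - {v}" "w \<in> V - (V - {v})" "nbr A u w" for u w
      using that assms(2) by (auto simp: nbr_def)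
    show "A v \<subseteq> V - {v}" using below[OF assms(1)] by blast
  qed (use assms p in auto)
  then show ?thesis using p by simp
qed

text \<open>The largest vertex of \<open>desc v\<close> will do: a vertex having it as a lower
  neighbour would be a larger member.\<close>

lemma leaf_below:
  assumes "v \<in> V"
  obtains l where "l \<in> desc v" "\<And>w. w \<in> V \<Longrightarrow> l \<notin> A w"
proof -
  have fin: "finite (desc v)" using desc_V assms finV by (meson finite_subset subsetI)
  have ne: "desc v \<noteq> {}" using desc_refl by blast
  have "Max (desc v) \<notin> A w" if "w \<in> V" for w
  proof
    assume *: "Max (desc v) \<in> A w"
    then have "w \<in> desc v" using desc_step[OF Max_in[OF fin ne] that] by blast
    then show False using below[OF that *] Max_ge[OF fin, of w] by simp
  qed
  then show ?thesis using that Max_in[OF fin ne] by blast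
qed

text \<open>The largest member \<open>t\<close> of \<open>X\<close> has at most \<open>k\<close>
  lower neighbours, while \<open>X\<close> has more than \<open>k\<close> further members, so one of
  these escapes \<open>A t\<close>. Being an ancestor of \<open>l\<close> as well, it is comparable
  with \<open>t\<close>.\<close>

lemma separated_pair:
  assumes l: "l \<in> V" and "X \<subseteq> {t \<in> V. l \<in> desc t}" "k + 1 < card X"
  obtains s t where "s \<in> X" "t \<in> X" "t \<in> desc s" "s \<notin> A t" "s \<noteq> t"
proof -
  have X: "finite X" "X \<noteq> {}" using assms(2,3) finV by (auto intro: finite_subset)
  define t where "t = Max X"
  have t: "t \<in> X" "t \<in> V" using Max_in X assms(2) by (auto simp: t_def)
  have "card (A t) < card (X - {t})" using card_le[OF t(2)] assms(3) t X by simp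
  then have "\<not> X - {t} \<subseteq> A t" using finA[OF t(2)] card_mono not_less by metis
  then obtain s where s: "s \<in> X" "s \<noteq> t" "s \<notin> A t" by blast
  have "s \<le> t" using s X by (simp add: t_def)
  moreover have "par\<^sup>*\<^sup>* s l" "par\<^sup>*\<^sup>* t l" using assms(2) s t by (auto simp: desc_def)
  ultimately have "par\<^sup>*\<^sup>* s t" using par_chain l t by blast
  then show ?thesis using that s t by (simp add: desc_def)
qed

end

text \<open>Vertices are removed as long as the bound is exceeded. Once every leaf is special, each
  vertex has one of the \<open>card Sp\<close> special vertices in its subtree, so some special
  vertex lies in the subtrees of many. Sorting these by colour, of which there are at most
  \<open>card (Pow Sp \<times> Pow (I \<times> I))\<close>, leaves more than \<open>k + 1\<close> of
  one colour, as \<open>separated_pair\<close> demands.\<close>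

lemma bounded_walks:
  fixes a z :: "'j \<Rightarrow> nat \<times> 's"
  assumes "peo k V A" "finite I" "\<And>j. j \<in> I \<Longrightarrow> transp (P j)" "Sp \<subseteq> V"
    and "\<And>j. j \<in> I \<Longrightarrow> fst (a j) \<in> Sp \<and> fst (z j) \<in> Sp"
    and "\<And>j. j \<in> I \<Longrightarrow> (step V A (P j))\<^sup>*\<^sup>* (a j) (z j)"
  shows "\<exists>V' A'. peo k V' A' \<and> Sp \<subseteq> V' \<and> V' \<subseteq> V \<and>
    (\<forall>j\<in>I. (step V' A' (P j))\<^sup>*\<^sup>* (a j) (z j)) \<and>
    card V' \<le> card Sp * ((k + 1) * card (Pow Sp \<times> Pow (I \<times> I)))"
  using assms(1,4,6)
proof (induction "card V" arbitrary: V A rule: less_induct)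
  case less
  interpret peo k V A by (rule less.prems)
  let ?c = "(k + 1) * card (Pow Sp \<times> Pow (I \<times> I))"
  have IH: ?case if "peo k V' A'" "Sp \<subseteq> V'" "V' \<subseteq> V" "card V' < card V"
    "\<And>j. j \<in> I \<Longrightarrow> (step V' A' (P j))\<^sup>*\<^sup>* (a j) (z j)" for V' A'
    using less.hyps[OF that(4,1,2,5)] that(3) by (meson order.trans)
  have finSp: "finite Sp" using less.prems(2) finV finite_subset by blast
  show ?case
  proof (cases "card V \<le> card Sp * ?c")
    case True
    then show ?thesis using less.prems by (intro exI[of _ V] exI[of _ A]) auto
  next
    case big: False
    show ?thesis
    proof (cases "\<exists>v\<in>V - Sp. \<forall>w\<in>V. v \<notin> A w")
      case True
      then obtain v where v: "v \<in> V" "v \<notin> Sp" "\<And>w. w \<in> V \<Longrightarrow> v \<notin> A w" by blast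
      show ?thesis
      proof (rule IH)
        show "peo k (V - {v}) A" using remove_leaf v by blast
        show "card (V - {v}) < card V" using v finV by (meson card_Diff1_less)
        show "(step (V - {v}) A (P j))\<^sup>*\<^sup>* (a j) (z j)" if "j \<in> I" for j
          using remove_leaf_walk[OF v(1,3)] less.prems assms(3,5)[OF that] that v(2) by blast
      qed (use less.prems v in auto)
    next
      case False
      let ?anc = "\<lambda>l. {t \<in> V. l \<in> desc t}"
      have "V \<subseteq> (\<Union>l\<in>Sp. ?anc l)"
      proof
        fix v assume "v \<in> V"
        then obtain l where "l \<in> desc v" "\<And>w. w \<in> V \<Longrightarrow> l \<notin> A w" using leaf_below by blast
        moreover from this have "l \<in> Sp" using False desc_V \<open>v \<in> V\<close> by blast
        ultimately show "v \<in> (\<Union>l\<in>Sp. ?anc l)" using \<open>v \<in> V\<close> by blast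
      qed
      then have "V = (\<Union>l\<in>Sp. ?anc l)" by blast
      then have "card V \<le> (\<Sum>l\<in>Sp. card (?anc l))" using card_UN_le[OF finSp] by metis
      then have "\<exists>l\<in>Sp. ?c < card (?anc l)"
        using big sum_bounded_above[of Sp "\<lambda>l. card (?anc l)" ?c] by (force simp: not_less)
      then obtain l where l: "l \<in> Sp" "?c < card (?anc l)" by blast
      have "\<forall>j\<in>I. \<exists>p r. p 0 = a j \<and> p r = z j \<and> (\<forall>i<r. step V A (P j) (p i) (p (Suc i)))"
        using rtranclp_seq[OF less.prems(3)] by (metis (no_types, lifting))
      from bchoice[OF this] obtain p where
        "\<forall>j\<in>I. \<exists>r. p j 0 = a j \<and> p j r = z j \<and> (\<forall>i<r. step V A (P j) (p j i) (p j (Suc i)))" ..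
      from bchoice[OF this] obtain r where p: "\<And>j. j \<in> I \<Longrightarrow> p j 0 = a j"
        "\<And>j. j \<in> I \<Longrightarrow> p j (r j) = z j"
        "\<And>j i. j \<in> I \<Longrightarrow> i < r j \<Longrightarrow> step V A (P j) (p j i) (p j (Suc i))"
        by blast
      define lv where "lv t j = fst (p j (last_visit (p j) (r j) (A t)))" for t j
      \<comment> \<open>Equal first components keep all special vertices, in particular the ends of
        the walks, on the two sides that survive; equal second components give
        \<open>pattern\<close>.\<close>
      define colour where
        "colour t = (Sp \<inter> desc t, {(i, j). i \<in> I \<and> j \<in> I \<and> lv t i = lv t j})" for t
      obtain y where y: "k + 1 < card {t \<in> ?anc l. colour t = y}"
        by (rule large_fibre[of "Pow Sp \<times> Pow (I \<times> I)" colour "?anc l" "k + 1"])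
          (use l finSp assms(2) in \<open>auto simp: colour_def\<close>)
      obtain s t where st: "s \<in> {t \<in> ?anc l. colour t = y}" "t \<in> {t \<in> ?anc l. colour t = y}"
        "t \<in> desc s" "s \<notin> A t" "s \<noteq> t"
        using separated_pair[OF _ _ y, of l] l less.prems by blast
      then have pat: "lv s i = lv s j" if "i \<in> I" "j \<in> I" "lv t i = lv t j" for i j
        using that by (auto simp: colour_def)
      have sp: "Sp \<inter> desc s = Sp \<inter> desc t" using st by (auto simp: colour_def)
      interpret C: contraction k V A s t I "lv s" "lv t"
      proof
        show "lv s i = lv s j" if "i \<in> I" "j \<in> I" "lv t i = lv t j" for i j
          using pat that .
      qed (use st in simp_all)
      show ?thesis
      proof (rule IH)
        show "(step C.V' C.A' (P j))\<^sup>*\<^sup>* (a j) (z j)" if "j \<in> I" for j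
        proof -
          have "x \<in> (V - desc s) \<union> desc t" if "x \<in> Sp" for x
            using that less.prems(2) sp by blast
          then have "(step C.V' C.A' (P j))\<^sup>*\<^sup>* (p j 0) (p j (r j))"
            using assms(5)[OF that] p(1,2)[OF that]
            by (intro C.contract_walk[where p = "p j" and r = "r j", OF assms(3)[OF that] p(3)[OF that] that])
              (simp_all add: lv_def)
          then show ?thesis using p(1,2)[OF that] by simp
        qed
        show "Sp \<subseteq> C.V'" using less.prems(2) sp by (auto simp: C.V'_def)
      qed (use C.peo' C.V'_V C.V'_card in auto)
    qed
  qed
qed

section \<open>Tree decompositions and elimination orderings\<close>

lemma peo_insert:
  assumes "peo k V A" "\<And>v. v \<in> V \<Longrightarrow> v < n" "C \<subseteq> V" "card C \<le> k"
    and "\<And>u w. u \<in> C \<Longrightarrow> w \<in> C \<Longrightarrow> nbr A u w"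
  shows "peo k (insert n V) (A(n := C))"
proof -
  interpret peo k V A by fact
  have n: "n \<notin> V" "n \<notin> A v" if "v \<in> V" for v
    using assms(2)[of n] below[OF that] by auto
  show ?thesis
  proof
    fix v u w assume v: "v \<in> insert n V" "u \<in> (A(n := C)) v" "w \<in> (A(n := C)) v" "u < w"
    show "u \<in> (A(n := C)) w"
    proof (cases "v = n")
      case True
      then have uw: "u \<in> C" "w \<in> C" using v by auto
      then have "w \<in> V" "u \<in> V" "w < n" using assms by auto
      moreover have "w \<notin> A u" using below[OF \<open>u \<in> V\<close>, of w] v by auto
      ultimately show ?thesis using assms(5)[OF uw] v by (auto simp: nbr_def)
    next
      case False
      then have "u \<in> A w" "w \<in> V" using v clique[of v u w] below by auto
      then show ?thesis using assms(2)[of w] by auto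
    qed
  next
    fix v u assume "v \<in> insert n V" "u \<in> (A(n := C)) v"
    then show "u \<in> insert n V \<and> u < v"
      using assms(2,3) below[of v u] by (cases "v = n") auto
  qed (use finV card_le assms in \<open>auto split: if_splits\<close>)
qed

lemma nbr_fun_upd:
  assumes "nbr A u v" "u \<noteq> n" "v \<noteq> n"
  shows "nbr (A(n := C)) u v"
  using assms by (auto simp: nbr_def)

text \<open>The vertices of \<open>Q\<close> are numbered one by one above everything so far, each
  joined to \<open>C\<close> and to those of \<open>Q\<close> before it. The last one has
  \<open>card (C \<union> Q) - 1\<close> lower neighbours, whence the bound
  \<open>k + 1\<close>.\<close>

lemma peo_extend:
  assumes "finite Q" "peo k (num ` U) A" "inj_on num U" "Q \<inter> U = {}" "C \<subseteq> U" "finite C"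
    and "card (C \<union> Q) \<le> k + 1" "\<And>u w. u \<in> C \<Longrightarrow> w \<in> C \<Longrightarrow> nbr A (num u) (num w)"
  shows "\<exists>num' A'. peo k (num' ` (U \<union> Q)) A' \<and> inj_on num' (U \<union> Q) \<and>
    (\<forall>u\<in>U. num' u = num u) \<and> (\<forall>u\<in>U. \<forall>w\<in>U. nbr A (num u) (num w) \<longrightarrow> nbr A' (num u) (num w)) \<and>
    (\<forall>u \<in> C \<union> Q. \<forall>w \<in> C \<union> Q. nbr A' (num' u) (num' w))"
  using assms(1,4,7)
proof (induction Q rule: finite_induct)
  case empty
  then show ?case using assms(2,3,8) by (intro exI[of _ num] exI[of _ A]) auto
next
  case (insert q Q)
  have q: "q \<notin> C \<union> Q" using insert assms(5) by blast
  then have "card (C \<union> insert q Q) = Suc (card (C \<union> Q))"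
    using insert(1) assms(6) by simp
  then have card: "card (C \<union> Q) \<le> k" using insert.prems by simp
  then obtain num' A' where IH: "peo k (num' ` (U \<union> Q)) A'" "inj_on num' (U \<union> Q)"
    "\<forall>u\<in>U. num' u = num u" "\<forall>u\<in>U. \<forall>w\<in>U. nbr A (num u) (num w) \<longrightarrow> nbr A' (num u) (num w)"
    "\<forall>u \<in> C \<union> Q. \<forall>w \<in> C \<union> Q. nbr A' (num' u) (num' w)"
    using insert.IH insert.prems by auto
  define n where "n = Suc (Max (insert 0 (num' ` (U \<union> Q))))"
  have n: "num' v < n" if "v \<in> U \<union> Q" for v
    unfolding n_def using that peo.finV[OF IH(1)] by (simp add: less_Suc_eq_le)
  have nq: "q \<notin> U \<union> Q" using insert by blast
  define num'' where "num'' = num'(q := n)"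
  have eq: "num'' v = num' v" if "v \<in> U \<union> Q" for v using that nq by (auto simp: num''_def)
  define A'' where "A'' = A'(n := num' ` (C \<union> Q))"
  have keep: "nbr A'' (num'' u) (num'' w)" if "u \<in> U \<union> Q" "w \<in> U \<union> Q" "nbr A' (num' u) (num' w)" for u w
    unfolding A''_def using nbr_fun_upd[OF that(3)] n[OF that(1)] n[OF that(2)] eq that by simp
  have "peo k (insert n (num' ` (U \<union> Q))) A''"
    unfolding A''_def
  proof (rule peo_insert[OF IH(1)])
    show "card (num' ` (C \<union> Q)) \<le> k"
      using card insert(1) assms(6) by (meson card_image_le finite_UnI le_trans)
  qed (use n IH(5) assms(5) in auto)
  moreover have "num'' ` (U \<union> insert q Q) = insert n (num' ` (U \<union> Q))"
  proof -
    have "num'' ` (U \<union> insert q Q) = insert (num'' q) (num'' ` (U \<union> Q))" by blast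
    also have "num'' ` (U \<union> Q) = num' ` (U \<union> Q)" using eq by (rule image_cong[OF refl])
    finally show ?thesis by (simp add: num''_def)
  qed
  moreover have "inj_on num'' (U \<union> insert q Q)"
  proof -
    have "inj_on num'' (U \<union> Q)" using IH(2) eq inj_on_cong[of "U \<union> Q" num'' num'] by blast
    moreover have "num'' q \<notin> num'' ` (U \<union> Q)" using n eq by (force simp: num''_def)
    ultimately show ?thesis using nq by simp
  qed
  moreover have "num'' u = num u" if "u \<in> U" for u
    using that eq IH(3) by simp
  moreover have "nbr A'' (num u) (num w)" if "u \<in> U" "w \<in> U" "nbr A (num u) (num w)" for u w
    using keep[of u w] IH(3,4) eq that by simp
  moreover have "nbr A'' (num'' u) (num'' w)" if "u \<in> C \<union> insert q Q" "w \<in> C \<union> insert q Q" for u w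
  proof -
    have 1: "num'' v \<in> A'' (num'' q)" if "v \<in> C \<union> Q" for v
    proof -
      have "num'' q = n" by (simp add: num''_def)
      moreover have "num'' v = num' v" using eq[of v] that assms(5) by blast
      ultimately show ?thesis using that by (simp add: A''_def)
    qed
    have 2: "nbr A'' (num'' u) (num'' w)" if "u \<in> C \<union> Q" "w \<in> C \<union> Q" for u w
      using that keep IH(5) assms(5) by blast
    show ?thesis using that 1 2 by (auto simp: nbr_def)
  qed
  ultimately show ?case by (intro exI[of _ num''] exI[of _ A'']) auto
qed

section \<open>Connectivity in trees and adding a leaf\<close>

definition tadj :: "'t set \<Rightarrow> 't set set \<Rightarrow> 't \<Rightarrow> 't \<Rightarrow> bool" where
  "tadj N E u v \<longleftrightarrow> u \<in> N \<and> v \<in> N \<and> {u, v} \<in> E"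

lemma walk_rtranclp: "walk N E p \<Longrightarrow> (tadj N E)\<^sup>*\<^sup>* (hd p) (last p)"
proof (induction p)
  case (Cons x p)
  show ?case
  proof (cases p)
    case (Cons y q)
    then have "tadj N E x y" "walk N E p"
      using Cons.prems by (auto simp: walk_def tadj_def)
    then show ?thesis using Cons.IH \<open>p = y # q\<close> by (auto intro: converse_rtranclp_into_rtranclp)
  qed simp
qed (simp add: walk_def)

lemma rtranclp_walk:
  assumes "(tadj N E)\<^sup>*\<^sup>* u v" "u \<in> N"
  shows "\<exists>p. walk N E p \<and> hd p = u \<and> last p = v"
  using assms(1)
proof (induction rule: rtranclp_induct)
  case base
  then show ?case using assms(2) by (intro exI[of _ "[u]"]) (simp add: walk_def)
next
  case (step v w)
  then obtain p where p: "walk N E p" "hd p = u" "last p = v" by blast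
  then show ?case using step
    by (intro exI[of _ "p @ [w]"]) (auto simp: walk_def tadj_def successively_append_iff)
qed

lemma connected_in_iff:
  "connected_in N E \<longleftrightarrow> N \<noteq> {} \<and> (\<forall>u\<in>N. \<forall>v\<in>N. (tadj N E)\<^sup>*\<^sup>* u v)"
  proof -
  have "(\<exists>p. walk N E p \<and> hd p = u \<and> last p = v) \<longleftrightarrow> (tadj N E)\<^sup>*\<^sup>* u v" if "u \<in> N" for u v
    using rtranclp_walk[OF _ that, of E v] walk_rtranclp[of N E] by auto
  then show ?thesis unfolding connected_in_def by (intro conj_cong refl ball_cong) blast+
qed

lemma connected_in_singleton: "connected_in {t} E"
  by (simp add: connected_in_iff)

lemma connected_in_mono:
  assumes "connected_in N E" "E \<subseteq> E'"
  shows "connected_in N E'"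
proof -
  have "tadj N E \<le> tadj N E'" using assms(2) by (auto simp: tadj_def)
  then show ?thesis using assms(1) rtranclp_mono unfolding connected_in_iff by blast
qed

lemma connected_in_insert:
  assumes "connected_in N E" "t' \<in> N" "{t', t} \<in> E"
  shows "connected_in (insert t N) E"
proof -
  have le: "tadj N E \<le> tadj (insert t N) E" by (auto simp: tadj_def)
  have 1: "(tadj (insert t N) E)\<^sup>*\<^sup>* u v" if "u \<in> N" "v \<in> N" for u v
    using assms(1) that rtranclp_mono[OF le] unfolding connected_in_iff by blast
  have 2: "tadj (insert t N) E t t'" "tadj (insert t N) E t' t"
    using assms(2,3) by (auto simp: tadj_def insert_commute)
  have 3: "(tadj (insert t N) E)\<^sup>*\<^sup>* t v" "(tadj (insert t N) E)\<^sup>*\<^sup>* v t" if "v \<in> N" for v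
    using 1[OF assms(2) that] 1[OF that assms(2)] 2
    by (auto intro: converse_rtranclp_into_rtranclp rtranclp.rtrancl_into_rtrancl)
  show ?thesis using 1 3 by (auto simp: connected_in_iff)
qed

lemma is_tree_singleton: "is_tree {t} {}"
  by (auto simp: is_tree_def connected_in_singleton cycle_in_def)

lemma length_ge_2: "2 \<le> length xs \<longleftrightarrow> (\<exists>a b cs. xs = a # b # cs)"
  by (auto simp: numeral_2_eq_2 Suc_le_length_iff)

text \<open>A new cycle would pass through \<open>t\<close>, whose only neighbour is
  \<open>t'\<close>; but on a cycle of length at least 3 every vertex has two distinct
  neighbours.\<close>

lemma is_tree_insert:
  assumes "is_tree N E" "t' \<in> N" "t \<notin> N"
  shows "is_tree (insert t N) (insert {t', t} E)"
proof -
  let ?N = "insert t N" and ?E = "insert {t', t} E"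
  have sub: "E \<subseteq> {{u, v} | u v. u \<in> N \<and> v \<in> N \<and> u \<noteq> v}" and fin: "finite N"
    and con: "connected_in N E" and ac: "\<nexists>p. cycle_in N E p"
    using assms(1) by (auto simp: is_tree_def)
  have tE: "t \<notin> e" if "e \<in> E" for e using that sub assms(3) by blast
  have only: "u = t'" if "{u, t} \<in> ?E \<or> {t, u} \<in> ?E" for u
    using that tE by (auto simp: doubleton_eq_iff)
  have "\<not> cycle_in ?N ?E p" for p
  proof
    assume "cycle_in ?N ?E p"
    then have p: "set p \<subseteq> ?N" "successively (\<lambda>u v. {u, v} \<in> ?E) p" "distinct p" "3 \<le> length p"
      "{last p, hd p} \<in> ?E" by (auto simp: cycle_in_def walk_def)
    show False
    proof (cases "t \<in> set p")
      case False
      then have "successively (\<lambda>u v. {u, v} \<in> E) p"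
        by (intro successively_mono[OF p(2)]) (auto simp: doubleton_eq_iff)
      moreover have "{last p, hd p} \<in> E"
        using p(4,5) False by (cases p) (auto simp: doubleton_eq_iff split: if_splits)
      ultimately have "cycle_in N E p" using p False by (auto simp: cycle_in_def walk_def)
      then show False using ac by blast
    next
      case True
      \<comment> \<open>The cycle is a list, so \<open>t\<close> may be its first, its last or an
        inner entry; each time both cyclic neighbours turn out to be \<open>t'\<close>.\<close>
      then obtain xs ys where xy: "p = xs @ t # ys" by (meson split_list)
      show False
      proof (cases "xs = []")
        case True
        then have "length p = Suc (length ys)" using xy by simp
        then have "2 \<le> length ys" using p(4) by simp
        then obtain y z zs where ys: "ys = y # z # zs" unfolding length_ge_2 by blast
        then have "y = t'" "last p = t'"
          using p(2,5) xy True only[of y] only[of "last p"] by (auto simp del: last.simps)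
        then show False using p(3) xy True ys by (auto split: if_splits)
      next
        case xs: False
        then have l: "last xs = t'" using p(2) xy only[of "last xs"] by (auto simp: successively_append_iff)
        show False
        proof (cases "ys = []")
          case True
          then have "hd xs = t'" using p(5) xy xs only[of "hd xs"] by auto
          moreover have "length p = Suc (length xs)" using xy True by simp
          then have "2 \<le> length xs" using p(4) by simp
          then obtain a b cs where "xs = a # b # cs" unfolding length_ge_2 by blast
          ultimately show False using l p(3) xy by (auto split: if_splits)
        next
          case False
          then have "hd ys = t'"
            using p(2) xy only[of "hd ys"] by (cases ys) (auto simp: successively_append_iff)
          then show False using l p(3) xy xs False by (metis disjoint_iff distinct_append
                last_in_set hd_in_set list.set_intros(2))
        qed
      qed
    qed
  qed
  moreover have "connected_in ?N ?E"
    using connected_in_insert[OF connected_in_mono[OF con, of ?E] assms(2)] by blast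
  moreover have "?E \<subseteq> {{u, v} | u v. u \<in> ?N \<and> v \<in> ?N \<and> u \<noteq> v}"
  proof
    fix e assume "e \<in> ?E"
    then consider "e = {t', t}" | u v where "e = {u, v}" "u \<in> N" "v \<in> N" "u \<noteq> v"
      using sub by blast
    then show "e \<in> {{u, v} | u v. u \<in> ?N \<and> v \<in> ?N \<and> u \<noteq> v}"
      using assms(2,3) by cases blast+
  qed
  ultimately show ?thesis using fin unfolding is_tree_def by blast
qed

section \<open>From elimination orderings to tree decompositions\<close>

lemma peo_decomposition:
  assumes "peo k V A"
  shows "\<exists>(N :: nat set) E B. is_tree N E \<and> (\<forall>t\<in>N. B t \<subseteq> V \<and> card (B t) \<le> k + 1) \<and>
    (\<forall>v\<in>V. \<exists>t\<in>N. insert v (A v) \<subseteq> B t) \<and> (\<forall>v\<in>V. connected_in {t \<in> N. v \<in> B t} E)"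
proof -
  have "finite V" using assms peo.finV by blast
  then show ?thesis using assms
  proof (induction V rule: finite_linorder_max_induct)
    case empty
    \<comment> \<open>A tree has at least one node, so the empty graph gets a single empty
      bag.\<close>
    show ?case
      by (rule exI[of _ "{0}"], rule exI[of _ "{}"], rule exI[of _ "\<lambda>_. {}"])
        (simp add: is_tree_singleton)
  next
    case (insert n V)
    interpret peo k "insert n V" A by fact
    have nV: "n \<notin> V" using insert(2) by blast
    have An: "A n \<subseteq> V" using below[of n] by auto
    have "peo k V A"
    proof
      show "u \<in> V \<and> u < v" if "v \<in> V" "u \<in> A v" for u v
        using below[of v u] insert(2) that by auto
    qed (use finV card_le clique in auto)
    then obtain N :: "nat set" and E B where IH: "is_tree N E"
      "\<forall>t\<in>N. B t \<subseteq> V \<and> card (B t) \<le> k + 1" "\<forall>v\<in>V. \<exists>t\<in>N. insert v (A v) \<subseteq> B t"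
      "\<forall>v\<in>V. connected_in {t \<in> N. v \<in> B t} E"
      using insert.IH by blast
    have finN: "finite N" and "N \<noteq> {}" using IH(1) by (auto simp: is_tree_def connected_in_def)
    obtain t' where t': "t' \<in> N" "A n \<subseteq> B t'"
    proof (cases "A n = {}")
      case True
      then show ?thesis using that \<open>N \<noteq> {}\<close> by blast
    next
      case False
      \<comment> \<open>The clique \<open>A n\<close> is contained in \<open>insert u (A u)\<close>
        for its largest vertex \<open>u\<close>, hence in an existing bag, to which the bag of
        \<open>n\<close> is attached.\<close>
      define u where "u = Max (A n)"
      have fin: "finite (A n)" using finA by blast
      have u: "u \<in> A n" using False fin by (simp add: u_def)
      have "A n \<subseteq> insert u (A u)"
      proof
        fix w assume w: "w \<in> A n"
        then have "w \<le> u" using fin by (simp add: u_def)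
        then show "w \<in> insert u (A u)" using clique[of n w u] u w by (cases "w = u") auto
      qed
      then show ?thesis using that IH(3) u An by (meson order_trans subsetD)
    qed
    define t where "t = Suc (Max N)"
    have t: "t \<notin> N" using Max_ge[OF finN, of t] by (auto simp: t_def)
    define B' where "B' = B(t := insert n (A n))"
    let ?N = "insert t N" and ?E = "insert {t', t} E"
    have "card (insert n (A n)) \<le> k + 1"
      using card_le[of n] card_insert_le_m1[of "k + 1" "A n" n] by simp
    then have "\<forall>s\<in>?N. B' s \<subseteq> insert n V \<and> card (B' s) \<le> k + 1"
      using IH(2) An by (auto simp: B'_def)
    moreover have "\<exists>s\<in>?N. insert v (A v) \<subseteq> B' s" if "v \<in> insert n V" for v
    proof (cases "v = n")
      case False
      then have "v \<in> V" using that by simp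
      from bspec[OF IH(3) this] obtain s where s: "s \<in> N" "insert v (A v) \<subseteq> B s" ..
      then have "B' s = B s" using t by (auto simp: B'_def)
      then show ?thesis using s by blast
    qed (simp add: B'_def subset_insertI)
    moreover have "connected_in {s \<in> ?N. v \<in> B' s} ?E" if "v \<in> insert n V" for v
    proof (cases "v = n")
      case True
      then have "{s \<in> ?N. v \<in> B' s} = {t}" using IH(2) nV by (auto simp: B'_def)
      then show ?thesis using connected_in_singleton by metis
    next
      case False
      then have c: "connected_in {s \<in> N. v \<in> B s} ?E"
        using IH(4) that connected_in_mono by (metis insertE subset_insertI)
      show ?thesis
      proof (cases "v \<in> A n")
        case True
        then have "{s \<in> ?N. v \<in> B' s} = insert t {s \<in> N. v \<in> B s}" using t by (auto simp: B'_def)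
        then show ?thesis using connected_in_insert[OF c, of t' t] t' True by auto
      next
        case notin: False
        then have "{s \<in> ?N. v \<in> B' s} = {s \<in> N. v \<in> B s}" using t False by (auto simp: B'_def)
        then show ?thesis using c by simp
      qed
    qed
    ultimately show ?case using is_tree_insert[OF IH(1) t'(1) t]
      by (intro exI[of _ ?N] exI[of _ ?E] exI[of _ B']) blast
  qed
qed

text \<open>Bags are pulled back along \<open>g\<close>. Injectivity keeps them small, and the bags
  containing \<open>x\<close> are those that contained \<open>g x\<close>, so they remain
  connected.\<close>

lemma tree_width_le:
  assumes "peo k V A" "inj_on g (mverts H)" "g ` mverts H \<subseteq> V"
    and "\<And>e. e \<in># medges H \<Longrightarrow> \<exists>x\<in>mverts H. \<exists>y\<in>mverts H. e = {x, y} \<and> nbr A (g x) (g y)"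
  shows "tree_width H \<le> k"
proof -
  obtain N :: "nat set" and E B where D: "is_tree N E" "\<forall>t\<in>N. B t \<subseteq> V \<and> card (B t) \<le> k + 1"
    "\<forall>v\<in>V. \<exists>t\<in>N. insert v (A v) \<subseteq> B t" "\<forall>v\<in>V. connected_in {t \<in> N. v \<in> B t} E"
    using peo_decomposition[OF assms(1)] by blast
  have N: "finite N" "N \<noteq> {}" using D(1) by (auto simp: is_tree_def connected_in_def)
  define B' where "B' t = {x \<in> mverts H. g x \<in> B t}" for t
  have "\<exists>t\<in>N. e \<subseteq> B' t" if edge: "e \<in># medges H" for e
  proof -
    obtain x y where e: "x \<in> mverts H" "y \<in> mverts H" "e = {x, y}" "nbr A (g x) (g y)"
      using assms(4)[OF edge] by blast
    then have "g x \<in> V" "g y \<in> V" using assms(3) by auto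
    then have "\<exists>t\<in>N. g x \<in> B t \<and> g y \<in> B t"
      using e(4) D(3) unfolding nbr_def by (metis insert_iff subsetD)
    then show ?thesis using e by (auto simp: B'_def)
  qed
  moreover have "connected_in {t \<in> N. x \<in> B' t} E" if "x \<in> mverts H" for x
    using D(4) assms(3) that by (auto simp: B'_def image_subset_iff)
  ultimately have td: "tree_decomposition H N E B'"
    using D(1) by (auto simp: tree_decomposition_def B'_def)
  have "card (B' t) \<le> k + 1" if "t \<in> N" for t
  proof -
    have "card (B' t) \<le> card (B t)"
    proof (rule card_inj_on_le)
      show "inj_on g (B' t)" using assms(2) by (auto simp: B'_def inj_on_def)
      show "finite (B t)" using D(2) that peo.finV[OF assms(1)] finite_subset by blast
    qed (auto simp: B'_def)
    then show ?thesis using D(2) that le_trans by blast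
  qed
  then have "decomposition_width N B' \<le> k"
  proof -
    have "Max ((\<lambda>t. card (B' t)) ` N) \<le> k + 1"
      using N \<open>\<And>t. t \<in> N \<Longrightarrow> card (B' t) \<le> k + 1\<close> by (intro Max.boundedI) auto
    then show ?thesis by (simp add: decomposition_width_def)
  qed
  moreover have "tree_width H \<le> decomposition_width N B'"
    unfolding tree_width_def by (rule Least_le) (use td in blast)
  ultimately show ?thesis by simp
qed

section \<open>From tree decompositions to elimination orderings\<close>

text \<open>The first vertex of a longest path is a leaf.\<close>
lemma is_tree_leaf:
  assumes "is_tree N E" "u0 \<in> N" "v0 \<in> N" "u0 \<noteq> v0"
  obtains t t' where "t \<in> N" "t' \<in> N" "t \<noteq> t'" "{t, t'} \<in> E" "\<And>u. {t, u} \<in> E \<Longrightarrow> u = t'"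
proof -
  have sub: "E \<subseteq> {{u, v} | u v. u \<in> N \<and> v \<in> N \<and> u \<noteq> v}" and fin: "finite N"
    and con: "connected_in N E" and ac: "\<nexists>p. cycle_in N E p"
    using assms(1) by (auto simp: is_tree_def)
  let ?W = "\<lambda>p. walk N E p \<and> distinct p"
  have edge: "u \<in> N \<and> v \<in> N \<and> u \<noteq> v" if "{u, v} \<in> E" for u v
    using subsetD[OF sub that] by (auto simp: doubleton_eq_iff)
  have "(tadj N E)\<^sup>*\<^sup>* u0 v0" using con assms by (simp add: connected_in_iff)
  then obtain w where w: "{u0, w} \<in> E"
    using assms(4) by (cases rule: converse_rtranclpE) (auto simp: tadj_def)
  then have W0: "?W [u0, w]" using edge by (auto simp: walk_def)
  have bound: "length p < Suc (card N)" if "?W p" for p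
    using that card_mono[OF fin, of "set p"] by (auto simp: walk_def distinct_card less_Suc_eq_le)
  obtain p where p: "?W p" "\<And>q. ?W q \<Longrightarrow> length q \<le> length p"
    using ex_has_greatest_nat[of ?W "[u0, w]" length "Suc (card N)"] W0 bound by blast
  have "2 \<le> length p" using p(2)[OF W0] by simp
  then obtain t t' q where pt: "p = t # t' # q" unfolding length_ge_2 by blast
  have tt: "{t, t'} \<in> E" using p(1) pt by (simp add: walk_def)
  have "u = t'" if "{t, u} \<in> E" for u
  proof (rule ccontr)
    assume "u \<noteq> t'"
    have "u \<in> set p"
    proof (rule ccontr)
      assume "u \<notin> set p"
      then have "?W (u # p)" using p(1) pt that edge by (auto simp: walk_def insert_commute)
      then show False using p(2) by fastforce
    qed
    then have "u \<in> set q" using \<open>u \<noteq> t'\<close> edge that pt by auto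
    then obtain xs ys where q: "q = xs @ u # ys" by (meson split_list)
    have "cycle_in N E (t # t' # xs @ [u])"
      using p(1) pt q that
      by (auto simp: cycle_in_def walk_def successively_append_iff successively_Cons insert_commute hd_append)
    then show False using ac by blast
  qed
  then show ?thesis using that tt edge by blast
qed

text \<open>Folding \<open>t\<close> onto its only neighbour \<open>t'\<close> turns each walk into
  one that avoids \<open>t\<close>, because an edge at \<open>t\<close> collapses to a
  point.\<close>

lemma connected_in_remove_leaf:
  assumes "connected_in S E" "S \<noteq> {t}" "t' \<noteq> t" "\<And>u. {t, u} \<in> E \<Longrightarrow> u = t'"
  shows "connected_in (S - {t}) {e \<in> E. t \<notin> e}" "t \<in> S \<Longrightarrow> t' \<in> S"
proof -
  show t': "t' \<in> S" if "t \<in> S"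
  proof -
    obtain u where "u \<in> S" "u \<noteq> t" using assms(2) \<open>t \<in> S\<close> by blast
    then have "(tadj S E)\<^sup>*\<^sup>* t u" using assms(1) that by (simp add: connected_in_iff)
    then show ?thesis using \<open>u \<noteq> t\<close> assms(4) by (cases rule: converse_rtranclpE) (auto simp: tadj_def)
  qed
  let ?f = "\<lambda>x. if x = t then t' else x"
  let ?R = "tadj (S - {t}) {e \<in> E. t \<notin> e}"
  have edge: "?R\<^sup>*\<^sup>* (?f x) (?f y)" if "tadj S E x y" for x y
  proof -
    have e: "x \<in> S" "y \<in> S" "{x, y} \<in> E" using that by (simp_all add: tadj_def)
    consider "x = t" | "y = t" | "x \<noteq> t" "y \<noteq> t" by blast
    then show ?thesis
    proof cases
      case 1
      then have "y = t'" using assms(4) e by blast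
      then show ?thesis using 1 assms(3) by simp
    next
      case 2
      then have "x = t'" using assms(4)[of x] e by (simp add: insert_commute)
      then show ?thesis using 2 assms(3) by simp
    next
      case 3
      then have "?R x y" using e by (simp add: tadj_def)
      then show ?thesis using 3 by simp
    qed
  qed
  have path: "?R\<^sup>*\<^sup>* (?f x) (?f y)" if "(tadj S E)\<^sup>*\<^sup>* x y" for x y
    using that
  proof (induction rule: rtranclp_induct)
    case (step y z)
    show ?case by (rule rtranclp_trans[OF step.IH edge[OF step.hyps(2)]])
  qed simp
  have "?R\<^sup>*\<^sup>* u v" if "u \<in> S - {t}" "v \<in> S - {t}" for u v
    using path[of u v] that assms(1) by (simp add: connected_in_iff)
  moreover have "S - {t} \<noteq> {}" using assms(1,2) by (auto simp: connected_in_iff)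
  ultimately show "connected_in (S - {t}) {e \<in> E. t \<notin> e}" by (simp add: connected_in_iff)
qed

text \<open>Strip a leaf \<open>t\<close> of the tree, with neighbour \<open>t'\<close>. The
  vertices of \<open>B t\<close> that occur elsewhere also occur in \<open>B t'\<close> and so form
  a clique of the ordering already built; the others are added on top by
  \<open>peo_extend\<close>.\<close>

lemma decomposition_peo:
  assumes "is_tree N E" "\<And>t. t \<in> N \<Longrightarrow> finite (B t) \<and> card (B t) \<le> k + 1"
    and "\<And>v. v \<in> \<Union>(B ` N) \<Longrightarrow> connected_in {t \<in> N. v \<in> B t} E"
  shows "\<exists>num A. peo k (num ` \<Union>(B ` N)) A \<and> inj_on num (\<Union>(B ` N)) \<and>
    (\<forall>t\<in>N. \<forall>u\<in>B t. \<forall>v\<in>B t. nbr A (num u) (num v))"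
  using assms
proof (induction "card N" arbitrary: N E rule: less_induct)
  case less
  have fin: "finite N" and ne: "N \<noteq> {}"
    using less.prems(1) by (auto simp: is_tree_def connected_in_def)
  obtain t where t: "t \<in> N" using ne by blast
  show ?case
  proof (cases "N = {t}")
    case True
    have "peo k {} A" for A by unfold_locales auto
    then show ?thesis
      using peo_extend[of "B t" k "\<lambda>_. 0" "{}" "\<lambda>_. {}" "{}"] less.prems(2)[OF t] True by simp
  next
    case False
    then obtain u where "u \<in> N" "u \<noteq> t" using t by blast
    then obtain t t' where t: "t \<in> N" "t' \<in> N" "t \<noteq> t'" "{t, t'} \<in> E" "\<And>u. {t, u} \<in> E \<Longrightarrow> u = t'"
      using is_tree_leaf[OF less.prems(1) t] by metis
    let ?N = "N - {t}" and ?E = "{e \<in> E. t \<notin> e}"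
    let ?U = "\<Union>(B ` ?N)"
    note rem = connected_in_remove_leaf[OF _ _ t(3)[symmetric] t(5)]
    have "connected_in ?N ?E"
      using rem(1)[of N] less.prems(1) t(1-3) by (auto simp: is_tree_def)
    then have tree: "is_tree ?N ?E"
    proof -
      have "cycle_in N E p" if "cycle_in ?N ?E p" for p
        using that successively_mono[of "\<lambda>u v. {u, v} \<in> ?E" p "\<lambda>u v. {u, v} \<in> E"]
        by (auto simp: cycle_in_def walk_def)
      moreover have "?E \<subseteq> {{u, v} | u v. u \<in> ?N \<and> v \<in> ?N \<and> u \<noteq> v}"
      proof
        fix e assume e: "e \<in> ?E"
        then obtain u v where "e = {u, v}" "u \<in> N" "v \<in> N" "u \<noteq> v"
          using less.prems(1) unfolding is_tree_def by blast
        then show "e \<in> {{u, v} | u v. u \<in> ?N \<and> v \<in> ?N \<and> u \<noteq> v}" using e by blast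
      qed
      ultimately show ?thesis
        using less.prems(1) \<open>connected_in ?N ?E\<close> unfolding is_tree_def by blast
    qed
    have con: "connected_in {s \<in> ?N. v \<in> B s} ?E" if "v \<in> ?U" for v
    proof -
      have "{s \<in> N. v \<in> B s} \<noteq> {t}" using that by blast
      moreover have "connected_in {s \<in> N. v \<in> B s} E" using that by (intro less.prems(3)) blast
      ultimately have "connected_in ({s \<in> N. v \<in> B s} - {t}) ?E" using rem(1) by blast
      moreover have "{s \<in> N. v \<in> B s} - {t} = {s \<in> ?N. v \<in> B s}" by blast
      ultimately show ?thesis by metis
    qed
    have "card ?N < card N" using t fin by (meson card_Diff1_less)
    then have "\<exists>num A. peo k (num ` ?U) A \<and> inj_on num ?U \<and>
      (\<forall>s\<in>?N. \<forall>u\<in>B s. \<forall>v\<in>B s. nbr A (num u) (num v))"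
    proof (rule less.hyps[OF _ tree])
      show "finite (B s) \<and> card (B s) \<le> k + 1" if "s \<in> ?N" for s
        using less.prems(2)[of s] that by simp
    qed (rule con)
    then obtain num A where IH: "peo k (num ` ?U) A" "inj_on num ?U"
      "\<forall>s\<in>?N. \<forall>u\<in>B s. \<forall>v\<in>B s. nbr A (num u) (num v)"
      by blast
    have Bt: "v \<in> B t'" if "v \<in> B t" "v \<in> ?U" for v
    proof -
      have "{s \<in> N. v \<in> B s} \<noteq> {t}" using that by blast
      moreover have "connected_in {s \<in> N. v \<in> B s} E" using that by (intro less.prems(3)) blast
      ultimately show ?thesis using rem(2) that t(1) by blast
    qed
    have "\<exists>num' A'. peo k (num' ` (?U \<union> (B t - ?U))) A' \<and> inj_on num' (?U \<union> (B t - ?U)) \<and>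
      (\<forall>u\<in>?U. num' u = num u) \<and> (\<forall>u\<in>?U. \<forall>w\<in>?U. nbr A (num u) (num w) \<longrightarrow> nbr A' (num u) (num w)) \<and>
      (\<forall>u \<in> (B t \<inter> ?U) \<union> (B t - ?U). \<forall>w \<in> (B t \<inter> ?U) \<union> (B t - ?U). nbr A' (num' u) (num' w))"
    proof (rule peo_extend)
      have "(B t \<inter> ?U) \<union> (B t - ?U) = B t" by blast
      then show "card ((B t \<inter> ?U) \<union> (B t - ?U)) \<le> k + 1" using less.prems(2)[OF t(1)] by simp
      show "nbr A (num u) (num w)" if "u \<in> B t \<inter> ?U" "w \<in> B t \<inter> ?U" for u w
        using IH(3) t(2,3) Bt that by blast
    qed (use IH less.prems(2)[OF t(1)] in auto)
    moreover have "?U \<union> (B t - ?U) = \<Union>(B ` N)" "(B t \<inter> ?U) \<union> (B t - ?U) = B t"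
      using t(1) by auto
    ultimately obtain num' A' where *: "peo k (num' ` \<Union>(B ` N)) A'" "inj_on num' (\<Union>(B ` N))"
      "\<forall>u\<in>?U. num' u = num u" "\<forall>u\<in>?U. \<forall>w\<in>?U. nbr A (num u) (num w) \<longrightarrow> nbr A' (num u) (num w)"
      "\<forall>u\<in>B t. \<forall>w\<in>B t. nbr A' (num' u) (num' w)"
      by metis
    have "nbr A' (num' u) (num' v)" if "s \<in> N" "u \<in> B s" "v \<in> B s" for s u v
    proof (cases "s = t")
      case False
      then have "u \<in> ?U" "v \<in> ?U" "nbr A (num u) (num v)" using IH(3) that by auto
      then show ?thesis using *(3,4) by metis
    qed (use *(5) that in blast)
    then show ?thesis using *(1,2) by blast
  qed
qed

lemma tree_width_peo:
  assumes "tree_width H \<le> k" "finite (mverts H)" "\<And>e. e \<in># medges H \<Longrightarrow> e \<subseteq> mverts H"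
  obtains num A where "peo k (num ` mverts H) A" "inj_on num (mverts H)"
    "\<And>x y. {x, y} \<in># medges H \<Longrightarrow> nbr A (num x) (num y)"
proof -
  \<comment> \<open>A single bag with all vertices shows that the \<open>LEAST\<close> in
    \<open>tree_width\<close> is attained.\<close>
  have "tree_decomposition H {0} {} (\<lambda>_. mverts H)"
    using assms(3) is_tree_singleton connected_in_singleton by (auto simp: tree_decomposition_def)
  then have "\<exists>w N E B. tree_decomposition H N E B \<and> decomposition_width N B = w" by blast
  from LeastI_ex[OF this] obtain N E B where
    D: "tree_decomposition H N E B" "decomposition_width N B = tree_width H"
    by (auto simp: tree_width_def)
  have tr: "is_tree N E" and B: "\<And>t. t \<in> N \<Longrightarrow> B t \<subseteq> mverts H"
    and con: "\<And>v. v \<in> mverts H \<Longrightarrow> connected_in {t \<in> N. v \<in> B t} E"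
    and ed: "\<And>e. e \<in># medges H \<Longrightarrow> \<exists>t\<in>N. e \<subseteq> B t"
    using D(1) by (auto simp: tree_decomposition_def)
  have "{t \<in> N. v \<in> B t} \<noteq> {}" if "v \<in> mverts H" for v
    using con[OF that] by (simp add: connected_in_def)
  then have U: "\<Union>(B ` N) = mverts H" using B by blast
  have "finite N" using tr by (simp add: is_tree_def)
  have card: "card (B t) \<le> k + 1" if "t \<in> N" for t
  proof -
    have "card (B t) \<le> Max ((\<lambda>t. card (B t)) ` N)" using \<open>finite N\<close> that by simp
    also have "\<dots> \<le> k + 1" using D(2) assms(1) by (simp add: decomposition_width_def)
    finally show ?thesis .
  qed
  have "\<exists>num A. peo k (num ` \<Union>(B ` N)) A \<and> inj_on num (\<Union>(B ` N)) \<and>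
    (\<forall>t\<in>N. \<forall>u\<in>B t. \<forall>v\<in>B t. nbr A (num u) (num v))"
  proof (intro decomposition_peo[OF tr])
    show "finite (B t) \<and> card (B t) \<le> k + 1" if "t \<in> N" for t
      using B[OF that] assms(2) card[OF that] finite_subset by blast
  qed (use con U in blast)
  then obtain num A where *: "peo k (num ` mverts H) A" "inj_on num (mverts H)"
    "\<forall>t\<in>N. \<forall>u\<in>B t. \<forall>v\<in>B t. nbr A (num u) (num v)"
    unfolding U by blast
  have "nbr A (num x) (num y)" if "{x, y} \<in># medges H" for x y
    using ed[OF that] *(3) by blast
  then show ?thesis using that[OF *(1,2)] by blast
qed

section \<open>Expansions\<close>

definition hom :: "('u \<Rightarrow> 'v) \<Rightarrow> ('u, 'l) lgraph \<Rightarrow> ('v, 'l) lgraph \<Rightarrow> bool" where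
  "hom h D G \<longleftrightarrow> h ` nodes D \<subseteq> nodes G \<and> (\<forall>(x, l, y) \<in> edges D. (h x, l, h y) \<in> edges G)"

lemma hom_two_way: "hom h D G \<Longrightarrow> hom h (two_way D) (two_way G)"
  by (auto simp: hom_def two_way_def)

lemma lpath_hom: "hom h D G \<Longrightarrow> lpath D x w y \<Longrightarrow> lpath G (h x) w (h y)"
proof (induction w arbitrary: x)
  case (Cons l w)
  then obtain z where "(x, l, z) \<in> edges D" "lpath D z w y" by auto
  then have "(h x, l, h z) \<in> edges G" "lpath G (h z) w (h y)"
    using Cons by (auto simp: hom_def)
  then show ?case by auto
qed (auto simp: hom_def)

lemma hom_comp: "hom g D E \<Longrightarrow> hom h E G \<Longrightarrow> hom (h \<circ> g) D G"
  by (fastforce simp: hom_def)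

lemma sat_hom:
  assumes "hom h D G" "sat D \<gamma> us"
  shows "sat G \<gamma> (map h us)"
proof -
  obtain f where f: "f ` vars \<gamma> \<subseteq> nodes D" "map f (outs \<gamma>) = us"
    "\<forall>(x, L, y) \<in> set (atoms \<gamma>). \<exists>w \<in> L. lpath (two_way D) (f x) w (f y)"
    using assms(2) unfolding sat_def by blast
  have "(h \<circ> f) ` vars \<gamma> \<subseteq> nodes G" using f(1) assms(1) by (auto simp: hom_def)
  moreover have "\<forall>(x, L, y) \<in> set (atoms \<gamma>). \<exists>w \<in> L. lpath (two_way G) ((h \<circ> f) x) w ((h \<circ> f) y)"
    using f(3) lpath_hom[OF hom_two_way[OF assms(1)]] by fastforce
  ultimately show ?thesis unfolding sat_def using f(2) by (intro exI[of _ "h \<circ> f"]) auto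
qed

text \<open>\<open>A\<close> witnesses that \<open>D\<close> has tree-width at most \<open>k\<close>.\<close>
definition cover ::
  "nat \<Rightarrow> (nat, 'a) lgraph \<Rightarrow> (nat \<Rightarrow> nat set) \<Rightarrow> (nat \<Rightarrow> 'v) \<Rightarrow> ('v, 'a) lgraph \<Rightarrow> bool" where
  "cover k D A h G \<longleftrightarrow> graph_db D \<and> peo k (nodes D) A \<and> hom h D G \<and>
     (\<forall>(x, l, y) \<in> edges D. nbr A x y)"

text \<open>Later steps of an expansion may merge vertices, so those of an earlier stage are
  followed along \<open>q\<close>. Paths already built survive because \<open>q\<close> is a
  homomorphism, and adjacency is kept so that the atoms still to be expanded have adjacent
  ends.\<close>

definition refines ::
  "(nat \<Rightarrow> nat) \<Rightarrow> (nat, 'a) lgraph \<Rightarrow> (nat \<Rightarrow> nat set) \<Rightarrow> (nat \<Rightarrow> 'v) \<Rightarrow>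
   (nat, 'a) lgraph \<Rightarrow> (nat \<Rightarrow> nat set) \<Rightarrow> (nat \<Rightarrow> 'v) \<Rightarrow> bool" where
  "refines q D A h D' A' h' \<longleftrightarrow> hom q D D' \<and> (\<forall>x\<in>nodes D. h' (q x) = h x) \<and>
     (\<forall>x\<in>nodes D. \<forall>y\<in>nodes D. nbr A x y \<longrightarrow> nbr A' (q x) (q y))"

lemma refines_id: "refines id D A h D A h"
  by (auto simp: refines_def hom_def)

lemma refines_comp:
  assumes "refines q D A h D' A' h'" "refines q' D' A' h' D'' A'' h''"
  shows "refines (q' \<circ> q) D A h D'' A'' h''"
proof -
  have "q x \<in> nodes D'" if "x \<in> nodes D" for x
    using assms(1) that by (auto simp: refines_def hom_def)
  then show ?thesis using assms hom_comp unfolding refines_def by (metis comp_apply)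
qed

text \<open>Contraction of an edge in a chordal graph. Where \<open>v\<close> is lost from some
  \<open>A w\<close>, at most \<open>u\<close> is gained, so no set grows. As \<open>u\<close>
  belongs to the clique \<open>A v\<close>, all other vertices of \<open>A v\<close> are adjacent to
  \<open>u\<close> already, and nothing is lost when \<open>v\<close> goes.\<close>

lemma peo_merge:
  assumes "peo k V A" "v \<in> V" "u \<in> A v"
  defines "A' \<equiv> \<lambda>w. if v \<in> A w then insert u (A w - {v}) else A w"
  defines "q \<equiv> id(v := u)"
  shows "peo k (V - {v}) A'" "\<And>x y. x \<in> V \<Longrightarrow> y \<in> V \<Longrightarrow> nbr A x y \<Longrightarrow> nbr A' (q x) (q y)"
proof -
  interpret peo k V A by fact
  have uv: "u \<in> V" "u < v" using below[OF assms(2,3)] by auto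
  have le: "x \<in> A' w" if "x \<in> A w" "x \<noteq> v" for x w
    using that by (auto simp: A'_def)
  have lu: "u \<in> A' w" if "v \<in> A w" for w
    using that by (auto simp: A'_def)
  show "peo k (V - {v}) A'"
  proof
    show "finite (V - {v})" using finV by simp
  next
    fix w x assume w: "w \<in> V - {v}" "x \<in> A' w"
    then have "x \<in> A w \<and> x \<noteq> v \<or> x = u \<and> v \<in> A w" by (auto simp: A'_def split: if_splits)
    then show "x \<in> V - {v} \<and> x < w" using w below[of w x] below[of w v] uv by auto
  next
    fix w assume w: "w \<in> V - {v}"
    then have fin: "finite (A w)" "card (A w) \<le> k" using finA card_le by auto
    show "card (A' w) \<le> k"
    proof (cases "v \<in> A w")
      case True
      then have "card (A' w) \<le> Suc (card (A w - {v}))"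
        by (simp add: A'_def card_insert_le_m1 fin card_insert_if)
      also have "\<dots> = card (A w)" using True fin by (meson card_Suc_Diff1)
      finally show ?thesis using fin by simp
    qed (use fin in \<open>simp add: A'_def\<close>)
  next
    fix w x y assume w: "w \<in> V - {v}" "x \<in> A' w" "y \<in> A' w" "x < y"
    then have wV: "w \<in> V" by simp
    consider (1) "x \<in> A w" "x \<noteq> v" "y \<in> A w" "y \<noteq> v" | (2) "y = u" "v \<in> A w" "x \<in> A w" "x \<noteq> v"
      | (3) "x = u" "v \<in> A w" "y \<in> A w" "y \<noteq> v"
      using w by (auto simp: A'_def split: if_splits)
    then show "x \<in> A' y"
    proof cases
      case 1
      then show ?thesis using clique[of w x y] wV w(4) le by blast
    next
      case 2
      then have "x \<in> A v" using clique[of w x v] wV w(4) uv by auto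
      then show ?thesis using 2 clique[of v x u] assms(2,3) w(4) le by blast
    next
      case 3
      show ?thesis
      proof (cases "y < v")
        case True
        then have "y \<in> A v" using 3 clique[of w y v] wV by blast
        then show ?thesis using 3 clique[of v u y] assms(2,3) w(4) le uv by blast
      next
        case False
        then have "v \<in> A y" using 3 clique[of w v y] wV by simp
        then show ?thesis using 3 lu by blast
      qed
    qed
  qed
  have *: "nbr A' (q x) (q y)" if "y \<in> V" "x \<in> A y" for x y
  proof -
    consider (1) "x = v" | (2) "y = v" "x = u" | (3) "y = v" "x < u" | (4) "y = v" "u < x" "x \<noteq> v"
      | (5) "x \<noteq> v" "y \<noteq> v" by linarith
    then show ?thesis
    proof cases
      case 1
      then have "y \<noteq> v" using that below[of y x] by auto
      then show ?thesis using 1 that lu[of y] by (simp add: q_def nbr_def)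
    next
      case 2
      then show ?thesis using uv by (simp add: q_def nbr_def)
    next
      case 3
      then have "x \<in> A u" "x \<noteq> v" using that clique[of v x u] assms(2,3) uv by auto
      then show ?thesis using 3 le[of x u] by (simp add: q_def nbr_def)
    next
      case 4
      then have "u \<in> A x" using that clique[of v u x] assms(2,3) by auto
      then show ?thesis using 4 le[of u x] uv by (simp add: q_def nbr_def)
    next
      case 5
      then show ?thesis using le[of x y] that by (simp add: q_def nbr_def)
    qed
  qed
  show "nbr A' (q x) (q y)" if "x \<in> V" "y \<in> V" "nbr A x y" for x y
  proof -
    consider "x = y" | "x \<in> A y" | "y \<in> A x" using \<open>nbr A x y\<close> by (auto simp: nbr_def)
    then show ?thesis
    proof cases
      case 1
      then show ?thesis by (simp add: nbr_def)
    qed (use * that nbr_sym in blast)+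
  qed
qed

lemma cover_merge:
  assumes "cover k D A h G" "v \<in> nodes D" "u \<in> A v" "h u = h v"
  shows "\<exists>D' A'. cover k D' A' h G \<and> refines (id(v := u)) D A h D' A' h"
proof -
  let ?q = "id(v := u)"
  define A' where "A' = (\<lambda>w. if v \<in> A w then insert u (A w - {v}) else A w)"
  define D' where "D' = \<lparr>nodes = nodes D - {v}, edges = (\<lambda>(x, l, y). (?q x, l, ?q y)) ` edges D\<rparr>"
  have D: "graph_db D" "peo k (nodes D) A" "hom h D G" "\<forall>(x, l, y) \<in> edges D. nbr A x y"
    using assms(1) by (auto simp: cover_def)
  have ends: "x \<in> nodes D" "y \<in> nodes D" if "(x, l, y) \<in> edges D" for x l y
    using D(1) that by (auto simp: graph_db_def)
  have uv: "u \<in> nodes D" "u \<noteq> v" using peo.below[OF D(2) assms(2,3)] by auto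
  note m = peo_merge[OF D(2) assms(2,3), folded A'_def]
  have hq: "h (?q x) = h x" for x using assms(4) by simp
  have qn: "?q x \<in> nodes D - {v}" if "x \<in> nodes D" for x using that uv by auto
  have "hom ?q D D'" using qn by (force simp: hom_def D'_def)
  moreover have "hom h D' G" using D(3) hq unfolding hom_def D'_def by (auto simp del: fun_upd_apply)
  moreover have "graph_db D'"
    using D(1) qn ends by (force simp: graph_db_def D'_def simp del: fun_upd_apply)
  moreover have "\<forall>(x, l, y) \<in> edges D'. nbr A' x y"
    using D(4) m(2) ends by (fastforce simp: D'_def simp del: fun_upd_apply)
  ultimately show ?thesis using m hq unfolding cover_def refines_def
    by (intro exI[of _ D'] exI[of _ A']) (simp add: D'_def del: fun_upd_apply)
qed

text \<open>An exhausted word identifies its two ends. Otherwise its first edge leads to a new vertex with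
  \<open>A n = {x, y}\<close>, which is where \<open>k \<ge> 2\<close> is needed.\<close>
lemma expand_path:
  fixes D :: "(nat, 'a) lgraph" and G :: "('v, 'a) lgraph"
  assumes "2 \<le> k" "graph_db G" "cover k D A h G" "x \<in> nodes D" "y \<in> nodes D" "nbr A x y"
    and "lpath (two_way G) (h x) w (h y)"
  shows "\<exists>D' A' h' q. cover k D' A' h' G \<and> refines q D A h D' A' h' \<and>
    lpath (two_way D') (q x) w (q y)"
  using assms(3-7)
proof (induction w arbitrary: D A h x)
  case Nil
  have nil: "lpath (two_way D') z [] z" if "z \<in> nodes D'" for D' :: "(nat, 'a) lgraph" and z
    using that by (simp add: two_way_def)
  \<comment> \<open>The smaller end survives the merge; it may be either of \<open>x\<close> and
    \<open>y\<close>.\<close>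
  have step: ?case if *: "u \<in> A v" "v \<in> nodes D" "h u = h v" "{x, y} = {u, v}" for u v
  proof -
    obtain D' A' where D': "cover k D' A' h G" "refines (id(v := u)) D A h D' A' h"
      using cover_merge[OF Nil.prems(1) *(2,1,3)] by blast
    then have "(id(v := u)) x \<in> nodes D'" using Nil.prems by (auto simp: refines_def hom_def)
    moreover have "(id(v := u)) x = (id(v := u)) y" using *(4) by (auto simp: doubleton_eq_iff)
    ultimately have "lpath (two_way D') ((id(v := u)) x) [] ((id(v := u)) y)" using nil by metis
    then show ?thesis using D' by blast
  qed
  consider "x = y" | "x \<in> A y" | "y \<in> A x" using Nil.prems by (auto simp: nbr_def)
  then show ?case
  proof cases
    case 1
    then show ?thesis using Nil.prems refines_id[of D A h] nil[of x D] by (metis id_apply)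
  next
    case 2
    then show ?thesis using step[of x y] Nil.prems by (simp add: two_way_def)
  next
    case 3
    then show ?thesis using step[of y x] Nil.prems by (simp add: two_way_def insert_commute)
  qed
next
  case (Cons l w)
  then obtain z where z: "(h x, l, z) \<in> edges (two_way G)" "lpath (two_way G) z w (h y)" by auto
  have D: "graph_db D" "peo k (nodes D) A" "hom h D G" "\<forall>(x, l, y) \<in> edges D. nbr A x y"
    using Cons.prems(1) by (auto simp: cover_def)
  have zG: "z \<in> nodes G" using z(1) assms(2) by (auto simp: two_way_def graph_db_def)
  define n where "n = Suc (Max (nodes D))"
  have n: "v < n" if "v \<in> nodes D" for v
    using that peo.finV[OF D(2)] by (simp add: n_def less_Suc_eq_le)
  then have nD: "n \<notin> nodes D" by blast
  obtain e where e: "(case l of Fwd a \<Rightarrow> e = (x, a, n) | Bwd a \<Rightarrow> e = (n, a, x))"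
    by (cases l) auto
  define D1 where "D1 = \<lparr>nodes = insert n (nodes D), edges = insert e (edges D)\<rparr>"
  define A1 where "A1 = A(n := {x, y})"
  define h1 where "h1 = h(n := z)"
  have ends: "x \<in> nodes D" "y \<in> nodes D" if "(x, l, y) \<in> edges D" for x l y
    using D(1) that by (auto simp: graph_db_def)
  have old: "nbr A1 u v" if "u \<in> nodes D" "v \<in> nodes D" "nbr A u v" for u v
    unfolding A1_def using nbr_fun_upd[OF that(3)] that nD by metis
  have nx: "nbr A1 n x" "nbr A1 x n" "nbr A1 n y" by (auto simp: A1_def nbr_def)
  have h1: "h1 u = h u" if "u \<in> nodes D" for u using that nD by (auto simp: h1_def)
  have c1: "cover k D1 A1 h1 G"
    unfolding cover_def
  proof (intro conjI)
    show "graph_db D1" using D(1) e Cons.prems(2) by (cases l) (auto simp: graph_db_def D1_def)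
    have "card {x, y} \<le> k" using assms(1) by (simp add: card_insert_if)
    then show "peo k (nodes D1) A1"
      unfolding D1_def A1_def using Cons.prems n D(2) nbr_sym
      by (auto intro!: peo_insert simp: nbr_def)
    show "hom h1 D1 G"
      unfolding hom_def
    proof
      show "h1 ` nodes D1 \<subseteq> nodes G" using D(3) h1 zG by (auto simp: D1_def h1_def hom_def)
      have "(h1 u, a, h1 v) \<in> edges G" if "(u, a, v) \<in> edges D" for u a v
        using that D(3) h1 ends[OF that] by (auto simp: hom_def)
      moreover have "\<forall>(u, a, v) \<in> {e}. (h1 u, a, h1 v) \<in> edges G"
        using z(1) e h1 Cons.prems(2) by (cases l) (auto simp: two_way_def h1_def)
      ultimately show "\<forall>(u, a, v) \<in> edges D1. (h1 u, a, h1 v) \<in> edges G" by (auto simp: D1_def)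
    qed
    show "\<forall>(u, a, v) \<in> edges D1. nbr A1 u v"
      using D(4) e ends old nx by (cases l) (fastforce simp: D1_def)+
  qed
  have "lpath (two_way G) (h1 n) w (h1 y)" using z(2) h1 Cons.prems(3) by (simp add: h1_def)
  \<comment> \<open>The rest of the word runs from \<open>n\<close> to \<open>y\<close>, which are
    adjacent, as the induction requires.\<close>
  then obtain D' A' h' q where IH: "cover k D' A' h' G" "refines q D1 A1 h1 D' A' h'"
    "lpath (two_way D') (q n) w (q y)"
    using Cons.IH[OF c1, of n] Cons.prems(3) nx by (auto simp: D1_def)
  have r1: "refines id D A h D1 A1 h1"
    using old h1 by (auto simp: refines_def hom_def D1_def)
  have "(x, l, n) \<in> edges (two_way D1)"
    using e by (cases l) (auto simp: two_way_def D1_def)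
  moreover have "hom q (two_way D1) (two_way D')"
    using IH(2) by (intro hom_two_way) (simp add: refines_def)
  ultimately have "(q x, l, q n) \<in> edges (two_way D')" by (auto simp: hom_def)
  then have "lpath (two_way D') (q x) (l # w) (q y)" using IH(3) by auto
  then show ?case using IH(1) refines_comp[OF r1 IH(2)] by (metis comp_id)
qed

text \<open>The indirection through \<open>c\<close> lets the induction continue with
  \<open>q1 \<circ> c\<close> after the first path has been expanded and vertices may have been
  merged.\<close>

lemma expand_paths:
  assumes "2 \<le> k" "graph_db G" "cover k D A h G"
    and "\<And>x w y. (x, w, y) \<in> set ps \<Longrightarrow> c x \<in> nodes D \<and> c y \<in> nodes D \<and> nbr A (c x) (c y) \<and>
      lpath (two_way G) (h (c x)) w (h (c y))"
  shows "\<exists>D' A' h' q. cover k D' A' h' G \<and> refines q D A h D' A' h' \<and>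
    (\<forall>(x, w, y) \<in> set ps. lpath (two_way D') (q (c x)) w (q (c y)))"
  using assms(3,4)
proof (induction ps arbitrary: D A h c)
  case Nil
  then show ?case using refines_id[of D A h] by auto
next
  case (Cons p ps)
  obtain x w y where p: "p = (x, w, y)" by (cases p)
  have "c x \<in> nodes D \<and> c y \<in> nodes D \<and> nbr A (c x) (c y) \<and>
      lpath (two_way G) (h (c x)) w (h (c y))" using Cons.prems(2)[of x w y] p by simp
  then obtain D1 A1 h1 q1 where 1: "cover k D1 A1 h1 G" "refines q1 D A h D1 A1 h1"
    "lpath (two_way D1) (q1 (c x)) w (q1 (c y))"
    using expand_path[OF assms(1,2) Cons.prems(1), of "c x" "c y" w] by blast
  have "\<exists>D' A' h' q. cover k D' A' h' G \<and> refines q D1 A1 h1 D' A' h' \<and>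
    (\<forall>(x, w, y) \<in> set ps. lpath (two_way D') (q ((q1 \<circ> c) x)) w (q ((q1 \<circ> c) y)))"
  proof (rule Cons.IH[OF 1(1)])
    fix x w y assume "(x, w, y) \<in> set ps"
    then show "(q1 \<circ> c) x \<in> nodes D1 \<and> (q1 \<circ> c) y \<in> nodes D1 \<and> nbr A1 ((q1 \<circ> c) x) ((q1 \<circ> c) y) \<and>
      lpath (two_way G) (h1 ((q1 \<circ> c) x)) w (h1 ((q1 \<circ> c) y))"
      using Cons.prems(2)[of x w y] 1(2) by (auto simp: refines_def hom_def)
  qed
  then obtain D' A' h' q where 2: "cover k D' A' h' G" "refines q D1 A1 h1 D' A' h'"
    "\<forall>(x, w, y) \<in> set ps. lpath (two_way D') (q ((q1 \<circ> c) x)) w (q ((q1 \<circ> c) y))"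
    by blast
  have "lpath (two_way D') (q (q1 (c x))) w (q (q1 (c y)))"
    using lpath_hom[OF hom_two_way 1(3)] 2(2) by (auto simp: refines_def)
  then have "\<forall>(x, w, y) \<in> set (p # ps). lpath (two_way D') ((q \<circ> q1) (c x)) w ((q \<circ> q1) (c y))"
    using 2(3) p by auto
  then show ?case using 2(1) refines_comp[OF 1(2) 2(2)] by blast
qed

lemma finite_vars: "finite (vars \<gamma>)"
  by (auto simp: vars_def)

lemma atom_vars: "(x, L, y) \<in> set (atoms \<gamma>) \<Longrightarrow> x \<in> vars \<gamma> \<and> y \<in> vars \<gamma>"
  unfolding vars_def by (intro conjI UnI2 UN_I[of "(x, L, y)"]) auto

text \<open>The starting point is the edgeless graph on the variables rather than on their images
  under \<open>f\<close>, which need not be injective; so the elimination ordering of the query is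
  available. One word per atom is then expanded.\<close>

lemma expansion:
  fixes G :: "('v, 'a) lgraph"
  assumes "2 \<le> k" "tree_width (underlying \<gamma>) \<le> k" "sat G \<gamma> us" "graph_db G"
  obtains D A h vs where "cover k D A h G" "sat D \<gamma> vs" "map h vs = us"
proof -
  obtain f where f: "f ` vars \<gamma> \<subseteq> nodes G" "map f (outs \<gamma>) = us"
    "\<forall>(x, L, y) \<in> set (atoms \<gamma>). \<exists>w \<in> L. lpath (two_way G) (f x) w (f y)"
    using assms(3) unfolding sat_def by blast
  obtain num A where A: "peo k (num ` vars \<gamma>) A" "inj_on num (vars \<gamma>)"
    "\<And>x y. {x, y} \<in># medges (underlying \<gamma>) \<Longrightarrow> nbr A (num x) (num y)"
  proof (rule tree_width_peo[OF assms(2)])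
    show "finite (mverts (underlying \<gamma>))" by (simp add: underlying_def finite_vars)
    show "e \<subseteq> mverts (underlying \<gamma>)" if "e \<in># medges (underlying \<gamma>)" for e
      using that by (auto simp: underlying_def dest: atom_vars)
  qed (auto simp: underlying_def)
  define D0 :: "(nat, 'a) lgraph" where "D0 = \<lparr>nodes = num ` vars \<gamma>, edges = {}\<rparr>"
  define h0 where "h0 = f \<circ> inv_into (vars \<gamma>) num"
  have h0: "h0 (num x) = f x" if "x \<in> vars \<gamma>" for x using that A(2) by (simp add: h0_def)
  have c0: "cover k D0 A h0 G"
    using A(1) f(1) h0 by (auto simp: finite_vars cover_def D0_def graph_db_def hom_def)
  define wd where "wd x L y = (SOME w. w \<in> L \<and> lpath (two_way G) (f x) w (f y))" for x y and L :: "'a letter list set"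
  have wd: "wd x L y \<in> L \<and> lpath (two_way G) (f x) (wd x L y) (f y)"
    if "(x, L, y) \<in> set (atoms \<gamma>)" for x L y
    unfolding wd_def by (rule someI_ex) (use f(3) that in blast)
  define ps where "ps = map (\<lambda>(x, L, y). (x, wd x L y, y)) (atoms \<gamma>)"
  have "\<exists>D' A' h' q. cover k D' A' h' G \<and> refines q D0 A h0 D' A' h' \<and>
    (\<forall>(x, w, y) \<in> set ps. lpath (two_way D') (q (num x)) w (q (num y)))"
  proof (rule expand_paths[OF assms(1) \<open>graph_db G\<close> c0])
    fix x w y assume "(x, w, y) \<in> set ps"
    then obtain L where L: "(x, L, y) \<in> set (atoms \<gamma>)" "w = wd x L y" by (auto simp: ps_def)
    then have v: "x \<in> vars \<gamma>" "y \<in> vars \<gamma>" using atom_vars[OF L(1)] by auto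
    have "{x, y} \<in># medges (underlying \<gamma>)" using L(1) by (force simp: underlying_def)
    then show "num x \<in> nodes D0 \<and> num y \<in> nodes D0 \<and> nbr A (num x) (num y) \<and>
      lpath (two_way G) (h0 (num x)) w (h0 (num y))"
      using v A(3) wd[OF L(1)] L(2) h0 by (simp add: D0_def)
  qed
  then obtain D' A' h' q where D': "cover k D' A' h' G" "refines q D0 A h0 D' A' h'"
    "\<forall>(x, w, y) \<in> set ps. lpath (two_way D') (q (num x)) w (q (num y))"
    by blast
  define g where "g = q \<circ> num"
  have "\<exists>w \<in> L. lpath (two_way D') (g x) w (g y)" if "(x, L, y) \<in> set (atoms \<gamma>)" for x L y
  proof -
    have "(x, wd x L y, y) \<in> set ps" using that by (force simp: ps_def)
    then show ?thesis using D'(3) wd[OF that] by (auto simp: g_def)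
  qed
  moreover have "g ` vars \<gamma> \<subseteq> nodes D'"
    using D'(2) by (auto simp: g_def refines_def hom_def D0_def)
  ultimately have "sat D' \<gamma> (map g (outs \<gamma>))"
    unfolding sat_def by (intro exI[of _ g]) auto
  moreover have "h' (g x) = f x" if "x \<in> vars \<gamma>" for x
    using that D'(2) h0 by (auto simp: g_def refines_def D0_def)
  then have "map h' (map g (outs \<gamma>)) = us" using f(2) by (auto simp: vars_def)
  ultimately show ?thesis using that D'(1) by blast
qed

section \<open>Refinements of bounded size\<close>

lemma lpath_append: "lpath G x u y \<Longrightarrow> lpath G y v z \<Longrightarrow> lpath G x (u @ v) z"
proof (induction u arbitrary: x)
  case (Cons l u)
  then obtain x' where "(x, l, x') \<in> edges G" "lpath G x' u y" by auto
  then show ?case using Cons.IH[OF _ Cons.prems(2)] by auto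
qed auto

lemma lpath_nodes:
  assumes "\<And>x l y. (x, l, y) \<in> edges G \<Longrightarrow> x \<in> nodes G" "lpath G x w y"
  shows "x \<in> nodes G" "y \<in> nodes G"
proof -
  show "x \<in> nodes G" using assms by (cases w) auto
  show "y \<in> nodes G" using assms(2) by (induction w arbitrary: x) auto
qed

lemma lpath_cong:
  assumes "nodes G = nodes H" "edges G = edges H"
  shows "lpath G x w y = lpath H x w y"
  using assms by (induction w arbitrary: x) auto

lemma nfa_edge:
  assumes "is_nfa M" "(p, l, q) \<in> edges M"
  shows "p \<in> nodes M" "q \<in> nodes M"
  using assms by (auto simp: is_nfa_def graph_db_def lgraph.truncate_def)

lemma nfa_path:
  assumes "is_nfa M" "lpath M p w q"
  shows "p \<in> nodes M" "q \<in> nodes M"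
  using lpath_nodes[OF nfa_edge(1)[OF assms(1)] assms(2)] by auto

definition segment :: "'l nfa \<Rightarrow> nat \<Rightarrow> nat \<Rightarrow> 'l list set" where
  "segment M p q = {w. lpath M p w q}"

lemma regular_segment:
  assumes "is_nfa M" "p \<in> nodes M" "q \<in> nodes M"
  shows "regular (segment M p q)"
proof -
  let ?M = "M\<lparr>initial := {p}, final := {q}\<rparr>"
  have "is_nfa ?M" using assms by (simp add: is_nfa_def graph_db_def lgraph.truncate_def)
  moreover have "nfa_language ?M = segment M p q"
    using lpath_cong[of ?M M] by (simp add: nfa_language_def segment_def)
  ultimately show ?thesis unfolding regular_def by metis
qed

lemma finite_segments:
  fixes m :: nat
  assumes "\<And>j. j < m \<Longrightarrow> is_nfa (M j)"
  shows "finite {segment (M j) p q | j p q. j < m \<and> p \<in> nodes (M j) \<and> q \<in> nodes (M j)}"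
    (is "finite ?L")
proof -
  have "finite (nodes (M j))" if "j < m" for j
    using assms[OF that] by (simp add: is_nfa_def graph_db_def lgraph.truncate_def)
  then have "finite (\<Union>j<m. \<Union>p\<in>nodes (M j). \<Union>q\<in>nodes (M j). {segment (M j) p q})" by auto
  moreover have "?L = (\<Union>j<m. \<Union>p\<in>nodes (M j). \<Union>q\<in>nodes (M j). {segment (M j) p q})" by blast
  ultimately show ?thesis by simp
qed

lemma segment_lists:
  assumes "\<And>p l q. (p, l, q) \<in> edges M \<Longrightarrow> l \<in> S"
  shows "segment M p q \<subseteq> lists S"
proof
  fix w assume "w \<in> segment M p q"
  then have "lpath M p w q" by (simp add: segment_def)
  then show "w \<in> lists S" using assms by (induction w arbitrary: p) auto
qed

text \<open>An automaton for \<open>L\<close> may have transitions with letters outside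
  \<open>S\<close> that lie on no accepting run. They have to be deleted, because the segments
  between arbitrary states must be languages over \<open>S\<close> too.\<close>

lemma regular_over:
  assumes "regular L" "L \<subseteq> lists S"
  obtains M where "is_nfa M" "L = nfa_language M" "\<And>p l q. (p, l, q) \<in> edges M \<Longrightarrow> l \<in> S"
proof -
  obtain M where M: "is_nfa M" "L = nfa_language M" using assms(1) by (auto simp: regular_def)
  let ?M = "M\<lparr>edges := {(p, l, q) \<in> edges M. l \<in> S}\<rparr>"
  have *: "lpath ?M p w q \<longleftrightarrow> lpath M p w q \<and> w \<in> lists S" for p w q
    by (induction w arbitrary: p) auto
  have "finite {(p, l, q) \<in> edges M. l \<in> S}"
    by (rule finite_subset[of _ "edges M"])
      (use M(1) in \<open>auto simp: is_nfa_def graph_db_def lgraph.truncate_def\<close>)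
  then have "is_nfa ?M" using M(1) by (auto simp: is_nfa_def graph_db_def lgraph.truncate_def)
  moreover have "L = nfa_language ?M"
    using * assms(2) unfolding M(2) nfa_language_def by (simp add: set_eq_iff subset_iff) blast
  ultimately show ?thesis by (rule that[of ?M]) simp
qed

text \<open>Reachability in the product of database and automaton. It is transitive by concatenation
  of words, which permits dropping positions.\<close>

definition reach ::
  "(nat, 'l) lgraph \<Rightarrow> 'l nfa \<Rightarrow> nat \<times> nat \<Rightarrow> nat \<times> nat \<Rightarrow> bool" where
  "reach G M = (\<lambda>(u, p) (v, q). \<exists>w. lpath G u w v \<and> lpath M p w q)"

lemma transp_reach: "transp (reach G M)"
proof (rule transpI)
  fix x y z assume *: "reach G M x y" "reach G M y z"
  obtain u p v q w r where "x = (u, p)" "y = (v, q)" "z = (w, r)" by (cases x; cases y; cases z)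
  then show "reach G M x z"
    using * lpath_append[of G u _ v _ w] lpath_append[of M p _ q _ r] unfolding reach_def by fast
qed

lemma product_walk:
  assumes "graph_db D" "is_nfa M" "\<And>x l y. (x, l, y) \<in> edges D \<Longrightarrow> nbr A x y"
    and "lpath (two_way D) u w v" "lpath M p w q"
  shows "(step (nodes D) A (reach (two_way D) M))\<^sup>*\<^sup>* (u, p) (v, q)"
  using assms(4,5)
proof (induction w arbitrary: u p)
  case (Cons l w)
  then obtain u' p' where e: "(u, l, u') \<in> edges (two_way D)" "lpath (two_way D) u' w v"
    "(p, l, p') \<in> edges M" "lpath M p' w q" by auto
  have u: "u \<in> nodes D" "u' \<in> nodes D"
    using e(1) assms(1) by (auto simp: two_way_def graph_db_def)
  then have "lpath (two_way D) u [l] u'" using e(1) by (simp add: two_way_def)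
  moreover have "lpath M p [l] p'" using e(3) nfa_edge[OF assms(2)] by auto
  moreover have "nbr A u u'" using e(1) assms(3) nbr_sym by (auto simp: two_way_def)
  ultimately have "step (nodes D) A (reach (two_way D) M) (u, p) (u', p')"
    using u by (auto simp: step_def reach_def intro: exI[of _ "[l]"])
  then show ?case using Cons.IH[OF e(2,4)] by (rule converse_rtranclp_into_rtranclp)
qed simp

text \<open>The query \<open>\<delta>\<close> has an atom for every segment language that holds between two adjacent vertices
  of the compressed graph. As \<open>\<gamma>\<close> is recovered from it by concatenation along the compressed walks,
  it need not be known which of these atoms the walks use.\<close>

lemma bounded_refinement:
  fixes M :: "nat \<Rightarrow> 'a letter nfa" and \<gamma> :: "('x, 'a) query"
  defines "m \<equiv> length (atoms \<gamma>)"
  defines "Ls \<equiv> {segment (M j) p q | j p q. j < m \<and> p \<in> nodes (M j) \<and> q \<in> nodes (M j)}"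
  assumes nfa: "\<And>j. j < m \<Longrightarrow> is_nfa (M j)"
    and lang: "\<And>j. j < m \<Longrightarrow> fst (snd (atoms \<gamma> ! j)) = nfa_language (M j)"
    and D: "graph_db D" "peo k (nodes D) A" "\<And>x l y. (x, l, y) \<in> edges D \<Longrightarrow> nbr A x y"
    and "sat D \<gamma> vs"
    and N: "card (vars \<gamma>) * ((k + 1) * (2 ^ card (vars \<gamma>) * 2 ^ (m * m))) \<le> N"
  shows "\<exists>\<delta> :: (nat, 'a) query. length (outs \<delta>) = length (outs \<gamma>) \<and> set (outs \<delta>) \<subseteq> {..<N} \<and>
    set (atoms \<delta>) \<subseteq> {..<N} \<times> Ls \<times> {..<N} \<and> distinct (atoms \<delta>) \<and>
    tree_width (underlying \<delta>) \<le> k \<and> sat D \<delta> vs \<and>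
    (\<forall>(G :: (nat, 'a) lgraph) us. sat G \<delta> us \<longrightarrow> sat G \<gamma> us)"
proof -
  define X where "X j = fst (atoms \<gamma> ! j)" for j
  define Y where "Y j = snd (snd (atoms \<gamma> ! j))" for j
  have at: "atoms \<gamma> ! j = (X j, nfa_language (M j), Y j)" if "j < m" for j
    using lang[OF that] by (metis X_def Y_def prod.collapse)
  have atm: "\<exists>j<m. (x, L, y) = (X j, nfa_language (M j), Y j)" if "(x, L, y) \<in> set (atoms \<gamma>)" for x L y
    using that at by (metis in_set_conv_nth m_def)
  have XY: "X j \<in> vars \<gamma>" "Y j \<in> vars \<gamma>" if "j < m" for j
    using at[OF that] atom_vars[of "X j" "nfa_language (M j)" "Y j" \<gamma>] that
    by (metis m_def nth_mem)+
  obtain f where f: "f ` vars \<gamma> \<subseteq> nodes D" "map f (outs \<gamma>) = vs"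
    "\<forall>(x, L, y) \<in> set (atoms \<gamma>). \<exists>w \<in> L. lpath (two_way D) (f x) w (f y)"
    using \<open>sat D \<gamma> vs\<close> unfolding sat_def by blast
  have "\<exists>w p q. lpath (two_way D) (f (X j)) w (f (Y j)) \<and> p \<in> initial (M j) \<and> q \<in> final (M j) \<and>
      lpath (M j) p w q" if "j < m" for j
  proof -
    have "(X j, nfa_language (M j), Y j) \<in> set (atoms \<gamma>)"
      using at[OF that] that by (metis m_def nth_mem)
    then have "\<exists>w \<in> nfa_language (M j). lpath (two_way D) (f (X j)) w (f (Y j))"
      using f(3) by blast
    then show ?thesis unfolding nfa_language_def by blast
  qed
  then obtain w p q where run: "\<And>j. j < m \<Longrightarrow> lpath (two_way D) (f (X j)) (w j) (f (Y j)) \<and>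
      p j \<in> initial (M j) \<and> q j \<in> final (M j) \<and> lpath (M j) (p j) (w j) (q j)"
    by metis
  define P where "P j = reach (two_way D) (M j)" for j
  define Sp where "Sp = f ` vars \<gamma>"
  have cSp: "finite Sp" "card Sp \<le> card (vars \<gamma>)"
    using finite_vars card_image_le by (auto simp: Sp_def)
  have "\<exists>V' A'. peo k V' A' \<and> Sp \<subseteq> V' \<and> V' \<subseteq> nodes D \<and>
    (\<forall>j\<in>{..<m}. (step V' A' (P j))\<^sup>*\<^sup>* (f (X j), p j) (f (Y j), q j)) \<and>
    card V' \<le> card Sp * ((k + 1) * card (Pow Sp \<times> Pow ({..<m} \<times> {..<m})))"
  proof (rule bounded_walks[OF D(2)])
    fix j assume j: "j \<in> {..<m}"
    show "(step (nodes D) A (P j))\<^sup>*\<^sup>* (f (X j), p j) (f (Y j), q j)"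
      unfolding P_def
    proof (rule product_walk[OF D(1)])
      show "lpath (two_way D) (f (X j)) (w j) (f (Y j))" "lpath (M j) (p j) (w j) (q j)"
        using run[of j] j by auto
    qed (use nfa j D(3) in auto)
    show "transp (P j)" by (simp add: P_def transp_reach)
  qed (use f(1) XY in \<open>auto simp: Sp_def\<close>)
  then obtain V' A' where V': "peo k V' A'" "Sp \<subseteq> V'" "V' \<subseteq> nodes D"
    "\<And>j. j < m \<Longrightarrow> (step V' A' (P j))\<^sup>*\<^sup>* (f (X j), p j) (f (Y j), q j)"
    "card V' \<le> card Sp * ((k + 1) * card (Pow Sp \<times> Pow ({..<m} \<times> {..<m})))"
    by blast
  have "card (Pow Sp \<times> Pow ({..<m} \<times> {..<m})) = 2 ^ card Sp * 2 ^ (m * m)"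
    using cSp by (simp add: card_cartesian_product card_Pow)
  moreover have "(2::nat) ^ card Sp \<le> 2 ^ card (vars \<gamma>)" using cSp by simp
  ultimately have "card Sp * ((k + 1) * card (Pow Sp \<times> Pow ({..<m} \<times> {..<m}))) \<le>
      card (vars \<gamma>) * ((k + 1) * (2 ^ card (vars \<gamma>) * 2 ^ (m * m)))"
    using cSp(2) by (metis mult_le_mono mult_le_mono1 mult_le_mono2)
  then have "card V' \<le> N" using V'(5) N by linarith
  have "finite V'" using V'(1) by (rule peo.finV)
  \<comment> \<open>Renaming into \<open>{..<N}\<close> makes the set of candidate queries
    independent of \<open>D\<close>.\<close>
  then obtain \<rho> where "bij_betw \<rho> V' {0..<card V'}" using ex_bij_betw_finite_nat by blast
  then have \<rho>: "inj_on \<rho> V'" "\<rho> ` V' \<subseteq> {..<N}"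
    using \<open>card V' \<le> N\<close> by (auto simp: bij_betw_def)
  define T where "T = {(\<rho> u, L, \<rho> v) | u L v. u \<in> V' \<and> v \<in> V' \<and> L \<in> Ls \<and> nbr A' u v \<and>
    (\<exists>w\<in>L. lpath (two_way D) u w v)}"
  have TI: "(\<rho> u, L, \<rho> v) \<in> T" if "u \<in> V'" "v \<in> V'" "L \<in> Ls" "nbr A' u v" "w \<in> L"
    "lpath (two_way D) u w v" for u L v w
    using that unfolding T_def by blast
  have finLs: "finite Ls" unfolding Ls_def using nfa by (rule finite_segments)
  have T: "T \<subseteq> {..<N} \<times> Ls \<times> {..<N}" using \<rho>(2) by (auto simp: T_def)
  then have "finite T" using finLs finite_subset by blast
  then obtain ts where ts: "set ts = T" "distinct ts" using finite_distinct_list by blast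
  define \<delta> :: "(nat, 'a) query" where "\<delta> = \<lparr>outs = map (\<rho> \<circ> f) (outs \<gamma>), atoms = ts\<rparr>"
  have \<delta>: "set (atoms \<delta>) = T" "outs \<delta> = map (\<rho> \<circ> f) (outs \<gamma>)" by (simp_all add: \<delta>_def ts)
  have fV: "f x \<in> V'" if "x \<in> vars \<gamma>" for x using that V'(2) by (auto simp: Sp_def)
  have outs: "x \<in> vars \<gamma>" if "x \<in> set (outs \<gamma>)" for x using that by (simp add: vars_def)
  have vars: "vars \<delta> \<subseteq> \<rho> ` V'"
    using fV outs unfolding vars_def[of \<delta>] \<delta> by (auto simp: T_def)
  define g where "g = inv_into V' \<rho>"
  have g: "g (\<rho> u) = u" if "u \<in> V'" for u using that \<rho>(1) by (simp add: g_def)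
  have gV: "g ` vars \<delta> \<subseteq> V'" using vars g by auto
  have tw: "tree_width (underlying \<delta>) \<le> k"
  proof (rule tree_width_le[OF V'(1), of g])
    show "inj_on g (mverts (underlying \<delta>))"
      using inj_on_inv_into[OF vars] by (simp add: underlying_def g_def)
    show "g ` mverts (underlying \<delta>) \<subseteq> V'" using gV by (simp add: underlying_def)
    fix e assume "e \<in># medges (underlying \<delta>)"
    then obtain x L y where "(x, L, y) \<in> set (atoms \<delta>)" "e = {x, y}"
      by (auto simp: underlying_def)
    moreover from this obtain u v where "x = \<rho> u" "y = \<rho> v" "u \<in> V'" "v \<in> V'" "nbr A' u v"
      by (auto simp: \<delta> T_def)
    ultimately show "\<exists>x\<in>mverts (underlying \<delta>). \<exists>y\<in>mverts (underlying \<delta>). e = {x, y} \<and> nbr A' (g x) (g y)"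
      using atom_vars[of x L y \<delta>] g
      by (intro bexI[of _ x] bexI[of _ y]) (simp_all add: underlying_def)
  qed
  \<comment> \<open>The words that witness the atoms run in \<open>D\<close> itself and may pass
    outside \<open>V'\<close>; the compressed graph only decides which pairs of vertices are
    joined.\<close>
  have satD: "sat D \<delta> vs"
    unfolding sat_def
  proof (intro exI[of _ g] conjI)
    show "g ` vars \<delta> \<subseteq> nodes D" using gV V'(3) by blast
    show "map g (outs \<delta>) = vs" using f(2) g fV outs by (auto simp: \<delta>)
    show "\<forall>(x, L, y)\<in>set (atoms \<delta>). \<exists>w\<in>L. lpath (two_way D) (g x) w (g y)"
      using g by (auto simp: \<delta> T_def)
  qed
  have sound: "sat G \<gamma> us" if "sat G \<delta> us" for G :: "(nat, 'a) lgraph" and us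
  proof -
    obtain h where h: "h ` vars \<delta> \<subseteq> nodes G" "map h (outs \<delta>) = us"
      "\<forall>(x, L, y) \<in> set (atoms \<delta>). \<exists>w \<in> L. lpath (two_way G) (h x) w (h y)"
      using \<open>sat G \<delta> us\<close> unfolding sat_def by blast
    have hT: "\<exists>w \<in> L. lpath (two_way G) (h x) w (h y)" if "(x, L, y) \<in> T" for x L y
      using h(3) that unfolding \<delta> by blast
    define c where "c = h \<circ> \<rho> \<circ> f"
    \<comment> \<open>The segment languages from a state to itself contain the empty word, so that \<open>\<delta>\<close> also mentions
      vertices at which all walks are trivial.\<close>
    have loop: "h (\<rho> (f x)) \<in> nodes G" if "j < m" "x \<in> vars \<gamma>" for j x
    proof -
      have pn: "p j \<in> nodes (M j)" using run[OF that(1)] nfa_path[OF nfa[OF that(1)]] by blast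
      have "(\<rho> (f x), segment (M j) (p j) (p j), \<rho> (f x)) \<in> T"
      proof (rule TI)
        show "segment (M j) (p j) (p j) \<in> Ls" using that(1) pn unfolding Ls_def by blast
        show "[] \<in> segment (M j) (p j) (p j)" using pn by (simp add: segment_def)
        show "lpath (two_way D) (f x) [] (f x)"
          using f(1) that(2) by (auto simp: two_way_def)
      qed (use fV that(2) in \<open>auto simp: nbr_def\<close>)
      then have "\<rho> (f x) \<in> vars \<delta>" using atom_vars[of _ _ _ \<delta>] unfolding \<delta> by blast
      then show ?thesis using h(1) by blast
    qed
    \<comment> \<open>The word read in \<open>G\<close> may differ from the one in \<open>D\<close>,
      but it leads between the same automaton states, so the pieces still compose to a run of
      \<open>M j\<close>.\<close>
    have path: "\<exists>w. lpath (two_way G) (c (X j)) w (h (\<rho> (fst e))) \<and> lpath (M j) (p j) w (snd e)"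
      if j: "j < m" and "(step V' A' (P j))\<^sup>*\<^sup>* (f (X j), p j) e" for j e
      using that(2)
    proof (induction rule: rtranclp_induct)
      case base
      have "p j \<in> nodes (M j)" using run[OF j] nfa_path[OF nfa[OF j]] by blast
      then show ?case using loop[OF j] XY(1)[OF j]
        by (intro exI[of _ "[]"]) (auto simp: c_def two_way_def)
    next
      case (step e e')
      obtain u s v t where e: "e = (u, s)" "e' = (v, t)" by (cases e; cases e')
      then obtain x where x: "lpath (two_way D) u x v" "lpath (M j) s x t"
        using step.hyps(2) by (auto simp: step_def P_def reach_def)
      have st: "s \<in> nodes (M j)" "t \<in> nodes (M j)" using nfa_path[OF nfa[OF j] x(2)] by auto
      have "(\<rho> u, segment (M j) s t, \<rho> v) \<in> T"
      proof (rule TI[OF _ _ _ _ _ x(1)])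
        show "segment (M j) s t \<in> Ls" using j st unfolding Ls_def by blast
      qed (use step.hyps(2) e x(2) in \<open>auto simp: step_def segment_def\<close>)
      then obtain y where y: "lpath (two_way G) (h (\<rho> u)) y (h (\<rho> v))" "lpath (M j) s y t"
        using hT unfolding segment_def by blast
      obtain z where "lpath (two_way G) (c (X j)) z (h (\<rho> u))" "lpath (M j) (p j) z s"
        using step.IH e by auto
      from lpath_append[OF this(1) y(1)] lpath_append[OF this(2) y(2)]
      show ?case using e by auto
    qed
    have "\<exists>w \<in> L. lpath (two_way G) (c x) w (c y)" if xy: "(x, L, y) \<in> set (atoms \<gamma>)" for x L y
    proof -
      obtain j where j: "j < m" "x = X j" "L = nfa_language (M j)" "y = Y j"
        using atm[OF xy] by blast
      then show ?thesis using path[OF j(1) V'(4)[OF j(1)]] run[OF j(1)]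
        by (auto simp: nfa_language_def c_def)
    qed
    moreover have "c ` vars \<gamma> \<subseteq> nodes G"
    proof
      fix z assume "z \<in> c ` vars \<gamma>"
      then obtain x where x: "x \<in> vars \<gamma>" "z = c x" by blast
      show "z \<in> nodes G"
      proof (cases "0 < m")
        case True
        then show ?thesis using loop x by (simp add: c_def)
      next
        case False
        \<comment> \<open>Without atoms every variable is an output variable.\<close>
        then have "x \<in> set (outs \<gamma>)" using x(1) by (simp add: vars_def m_def)
        then have "\<rho> (f x) \<in> vars \<delta>" by (simp add: vars_def \<delta>)
        then show ?thesis using h(1) x by (auto simp: c_def)
      qed
    qed
    moreover have "map c (outs \<gamma>) = us" using h(2) by (simp add: c_def \<delta> comp_assoc)
    ultimately show ?thesis unfolding sat_def by (intro exI[of _ c]) auto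
  qed
  have "set (outs \<delta>) \<subseteq> {..<N}" using \<rho>(2) fV outs by (auto simp: \<delta>)
  then show ?thesis using tw satD sound T ts(2) \<delta>
    by (intro exI[of _ \<delta>]) (simp add: \<delta>_def)
qed

lemma finite_queries:
  assumes "finite S" "finite T"
  shows "finite {\<delta> :: ('x, 'a) query. length (outs \<delta>) = n \<and> set (outs \<delta>) \<subseteq> S \<and>
    set (atoms \<delta>) \<subseteq> T \<and> distinct (atoms \<delta>)}" (is "finite ?Q")
proof (rule finite_subset)
  let ?F = "(\<lambda>(os, as). \<lparr>outs = os, atoms = as\<rparr> :: ('x, 'a) query) `
    ({os. set os \<subseteq> S \<and> length os = n} \<times> {as. set as \<subseteq> T \<and> distinct as})"
  show "finite ?F"
    using finite_lists_length_eq[OF assms(1)] finite_subset_distinct[OF assms(2)] by blast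
  show "?Q \<subseteq> ?F"
  proof
    fix \<delta> assume \<delta>: "\<delta> \<in> ?Q"
    have "\<delta> = (\<lambda>(os, as). \<lparr>outs = os, atoms = as\<rparr>) (outs \<delta>, atoms \<delta>)" by simp
    then show "\<delta> \<in> ?F" using \<delta> by (intro image_eqI[where x = "(outs \<delta>, atoms \<delta>)"]) auto
  qed
qed

text \<open>The bound \<open>N\<close> and the languages \<open>Ls\<close> depend only on
  \<open>\<gamma>\<close>, the chosen automata and \<open>k\<close>, so one finite \<open>C\<close>
  serves all databases. Some members of \<open>C\<close> may be too wide or fail to imply
  \<open>\<gamma>\<close>; the member found for a given \<open>D\<close> has both
  properties.\<close>

lemma finite_refinements:
  fixes \<gamma> :: "('x, 'a) query"
  assumes "crpq \<gamma>"
  shows "\<exists>C :: (nat, 'a) query set. finite C \<and> (\<forall>\<delta>\<in>C. crpq \<delta> \<and> length (outs \<delta>) = length (outs \<gamma>)) \<and>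
    (\<forall>D A vs. graph_db D \<longrightarrow> peo k (nodes D) A \<longrightarrow> (\<forall>(x, l, y) \<in> edges D. nbr A x y) \<longrightarrow> sat D \<gamma> vs \<longrightarrow>
      (\<exists>\<delta>\<in>C. tree_width (underlying \<delta>) \<le> k \<and> sat D \<delta> vs \<and>
        (\<forall>(G :: (nat, 'a) lgraph) us. sat G \<delta> us \<longrightarrow> sat G \<gamma> us)))"
proof -
  let ?m = "length (atoms \<gamma>)"
  have "\<exists>M. is_nfa M \<and> fst (snd (atoms \<gamma> ! j)) = nfa_language M \<and>
      (\<forall>(p, l, q) \<in> edges M. l \<in> range Fwd)" if "j < ?m" for j
  proof -
    obtain x L y where a: "atoms \<gamma> ! j = (x, L, y)" by (cases "atoms \<gamma> ! j")
    then have "(x, L, y) \<in> set (atoms \<gamma>)" using that by (metis nth_mem)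
    then have "regular L" "L \<subseteq> lists (range Fwd)"
      using assms unfolding crpq_def c2rpq_def by blast+
    then show ?thesis using a by (metis (no_types, lifting) case_prodI2 fst_conv regular_over snd_conv)
  qed
  then obtain M where M: "\<And>j. j < ?m \<Longrightarrow> is_nfa (M j) \<and> fst (snd (atoms \<gamma> ! j)) = nfa_language (M j) \<and>
      (\<forall>(p, l, q) \<in> edges (M j). l \<in> range Fwd)"
    by metis
  define Ls where "Ls = {segment (M j) p q | j p q. j < ?m \<and> p \<in> nodes (M j) \<and> q \<in> nodes (M j)}"
  define N where "N = card (vars \<gamma>) * ((k + 1) * (2 ^ card (vars \<gamma>) * 2 ^ (?m * ?m)))"
  define C :: "(nat, 'a) query set" where "C = {\<delta>. length (outs \<delta>) = length (outs \<gamma>) \<and>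
    set (outs \<delta>) \<subseteq> {..<N} \<and> set (atoms \<delta>) \<subseteq> {..<N} \<times> Ls \<times> {..<N} \<and> distinct (atoms \<delta>)}"
  have "finite Ls" unfolding Ls_def using M by (intro finite_segments) blast
  then have "finite C" unfolding C_def by (intro finite_queries) auto
  moreover have "crpq \<delta> \<and> length (outs \<delta>) = length (outs \<gamma>)" if "\<delta> \<in> C" for \<delta>
  proof -
    have "regular L \<and> L \<subseteq> lists (range Fwd)" if L: "L \<in> Ls" for L
    proof -
      obtain j p q where L: "L = segment (M j) p q" "j < ?m" "p \<in> nodes (M j)" "q \<in> nodes (M j)"
        using L unfolding Ls_def by blast
      then show ?thesis
        using regular_segment[of "M j" p q] segment_lists[of "M j" "range Fwd" p q] M[OF L(2)] by blast
    qed
    then show ?thesis using that by (force simp: C_def crpq_def c2rpq_def)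
  qed
  moreover have "\<exists>\<delta>\<in>C. tree_width (underlying \<delta>) \<le> k \<and> sat D \<delta> vs \<and>
        (\<forall>(G :: (nat, 'a) lgraph) us. sat G \<delta> us \<longrightarrow> sat G \<gamma> us)"
    if "graph_db D" "peo k (nodes D) A" "\<forall>(x, l, y) \<in> edges D. nbr A x y" "sat D \<gamma> vs" for D A vs
    using bounded_refinement[of \<gamma> M D k A vs N, folded Ls_def] M that
    unfolding C_def N_def by blast
  ultimately show ?thesis by blast
qed

theorem corollary3p15:
  fixes k n :: nat and \<Gamma> :: "(nat, 'a::finite) query set"
  assumes "k \<ge> 2" and "ucrpq n \<Gamma>"
  shows "semantic_tw_at_most k n \<Gamma> \<longleftrightarrow> one_way_semantic_tw_at_most k n \<Gamma>"
proof
  assume "one_way_semantic_tw_at_most k n \<Gamma>"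
  then show "semantic_tw_at_most k n \<Gamma>"
    unfolding one_way_semantic_tw_at_most_def semantic_tw_at_most_def ucrpq_def uc2rpq_def crpq_def
    by blast
next
  assume "semantic_tw_at_most k n \<Gamma>"
  then obtain \<Delta> :: "(nat, 'a) query set" where \<Delta>: "uc2rpq n \<Delta>" "equivalent \<Gamma> \<Delta>" "union_tree_width \<Delta> \<le> k"
    unfolding semantic_tw_at_most_def by blast
  have tw\<Delta>: "tree_width (underlying \<delta>) \<le> k" if "\<delta> \<in> \<Delta>" for \<delta>
  proof -
    have "finite \<Delta>" using \<Delta>(1) by (simp add: uc2rpq_def)
    then have "tree_width (underlying \<delta>) \<le> union_tree_width \<Delta>"
      unfolding union_tree_width_def using that by (intro Max_ge) auto
    then show ?thesis using \<Delta>(3) by simp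
  qed
  have \<Gamma>: "finite \<Gamma>" "\<And>\<gamma>. \<gamma> \<in> \<Gamma> \<Longrightarrow> crpq \<gamma> \<and> length (outs \<gamma>) = n"
    using assms(2) by (auto simp: ucrpq_def)
  define covers :: "(nat, 'a) query \<Rightarrow> (nat, 'a) query set \<Rightarrow> bool" where
    "covers \<gamma> C \<longleftrightarrow> finite C \<and> (\<forall>\<delta>\<in>C. crpq \<delta> \<and> length (outs \<delta>) = length (outs \<gamma>)) \<and>
      (\<forall>D A vs. graph_db D \<longrightarrow> peo k (nodes D) A \<longrightarrow> (\<forall>(x, l, y) \<in> edges D. nbr A x y) \<longrightarrow>
        sat D \<gamma> vs \<longrightarrow> (\<exists>\<delta>\<in>C. tree_width (underlying \<delta>) \<le> k \<and> sat D \<delta> vs \<and>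
          (\<forall>(G :: (nat, 'a) lgraph) us. sat G \<delta> us \<longrightarrow> sat G \<gamma> us)))" for \<gamma> C
  have "\<exists>C. covers \<gamma> C" if "\<gamma> \<in> \<Gamma>" for \<gamma>
    unfolding covers_def using \<Gamma>(2)[OF that] by (intro finite_refinements) simp
  then obtain C where C: "\<And>\<gamma>. \<gamma> \<in> \<Gamma> \<Longrightarrow> covers \<gamma> (C \<gamma>)" by metis
  define \<Delta>' where "\<Delta>' = {\<delta> \<in> (\<Union>\<gamma>\<in>\<Gamma>. C \<gamma>). tree_width (underlying \<delta>) \<le> k \<and>
    (\<forall>(G :: (nat, 'a) lgraph) us. sat G \<delta> us \<longrightarrow> usat G \<Gamma> us)}"
  have fin: "finite \<Delta>'" using \<Gamma>(1) C by (simp add: \<Delta>'_def covers_def)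
  have "crpq \<delta> \<and> length (outs \<delta>) = n" if \<delta>: "\<delta> \<in> \<Delta>'" for \<delta>
  proof -
    obtain \<gamma> where "\<gamma> \<in> \<Gamma>" "\<delta> \<in> C \<gamma>" using \<delta> by (auto simp: \<Delta>'_def)
    then show ?thesis using C[of \<gamma>] \<Gamma>(2)[of \<gamma>] by (simp add: covers_def)
  qed
  then have "ucrpq n \<Delta>'" using fin by (simp add: ucrpq_def)
  moreover have "union_tree_width \<Delta>' \<le> k"
    unfolding union_tree_width_def using fin by (subst Max_le_iff) (auto simp: \<Delta>'_def)
  moreover have "equivalent \<Gamma> \<Delta>'"
    unfolding equivalent_def
  proof (intro allI impI iffI)
    fix G :: "(nat, 'a) lgraph" and us
    assume G: "graph_db G"
    show "usat G \<Gamma> us" if "usat G \<Delta>' us"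
      proof -
      obtain \<delta> where "\<delta> \<in> \<Delta>'" "sat G \<delta> us" using \<open>usat G \<Delta>' us\<close> unfolding usat_def by blast
      then show ?thesis by (simp add: \<Delta>'_def)
    qed
    assume "usat G \<Gamma> us"
    then have "usat G \<Delta> us" using \<Delta>(2) G by (simp add: equivalent_def)
    then obtain \<delta> where \<delta>: "\<delta> \<in> \<Delta>" "sat G \<delta> us" by (auto simp: usat_def)
    obtain D A h vs where D: "cover k D A h G" "sat D \<delta> vs" "map h vs = us"
      using expansion[OF assms(1) tw\<Delta>[OF \<delta>(1)] \<delta>(2) G] by blast
    have c: "graph_db D" "peo k (nodes D) A" "hom h D G" "\<forall>(x, l, y) \<in> edges D. nbr A x y"
      using D(1) by (simp_all add: cover_def)
    \<comment> \<open>The equivalence is used a second time, now on the expansion: the elimination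
      ordering needed for the compression is available for \<open>D\<close>, not for
      \<open>G\<close>.\<close>
    have "usat D \<Delta> vs" using \<delta>(1) D(2) by (auto simp: usat_def)
    then have "usat D \<Gamma> vs" using \<Delta>(2) c(1) by (simp add: equivalent_def)
    then obtain \<gamma> where \<gamma>: "\<gamma> \<in> \<Gamma>" "sat D \<gamma> vs" by (auto simp: usat_def)
    then obtain \<delta>' where \<delta>': "\<delta>' \<in> C \<gamma>" "tree_width (underlying \<delta>') \<le> k" "sat D \<delta>' vs"
      "\<forall>(G :: (nat, 'a) lgraph) us. sat G \<delta>' us \<longrightarrow> sat G \<gamma> us"
      using C[OF \<gamma>(1)] c(1,2,4) unfolding covers_def by blast
    then have "\<delta>' \<in> \<Delta>'" using \<gamma>(1) by (auto simp: \<Delta>'_def usat_def)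
    moreover have "sat G \<delta>' us" using sat_hom[OF c(3) \<delta>'(3)] D(3) by simp
    ultimately show "usat G \<Delta>' us" by (auto simp: usat_def)
  qed
  ultimately show "one_way_semantic_tw_at_most k n \<Gamma>"
    unfolding one_way_semantic_tw_at_most_def by blast
qed

end
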